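(* Let $(\Delta^{1,0},\Delta^{0,1})$ be a $q$-constrained Willmore surface admitting $V$ as a $(q,d)$-central sphere congruence. For each $\lambda\in\mathbb{C}\backslash\{0\}$ let $\phi^\lambda_q:(\underline{\mathbb{C}}^{n+2},d^{\lambda,q}_V)\to(\underline{\mathbb{C}}^{n+2},d)$ be an isomorphism of bundles with metric and connection. Then, for each $\lambda\in\mathbb{C}\backslash\{0\}$, $(\phi^\lambda_q\Delta^{1,0},\phi^\lambda_q\Delta^{0,1})$ is an $\mathrm{Ad}_{\phi^\lambda_q}(q_\lambda)$-constrained Willmore surface admitting $\phi^\lambda_qV$ as an $(\mathrm{Ad}_{\phi^\lambda_q}(q_\lambda),d)$-central sphere congruence, where $q_\lambda:=\lambda^{-2}q^{1,0}+\lambda^2q^{0,1}$.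
   Context: $M$ is an oriented surface with a fixed conformal structure; $J$ is the induced complex structure, all $(1,0)$- and $(0,1)$-parts refer to it, and $*\omega=-\omega\circ J$ on $1$-forms. $\mathbb{R}^{n+1,1}$ ($n\ge 3$) has metric $(\,,\,)$ of signature $(n+1,1)$, extended complex bilinearly to $\mathbb{C}^{n+2}=(\mathbb{R}^{n+1,1})^{\mathbb{C}}$; $\underline{\mathbb{C}}^{n+2}=M\times\mathbb{C}^{n+2}$ with trivial flat connection $d$. The theory is local: restriction to a suitable non-empty open subset of $M$ is always understood. We identify $\wedge^{2}\mathbb{C}^{n+2}\cong o(\mathbb{C}^{n+2})$ by $(v_1\wedge v_2)(w)=(w,v_1)v_2-(w,v_2)v_1$. For $1$-forms with values in a bundle of Lie algebras, $[\mu\wedge\eta](X,Y)=[\mu_X,\eta_Y]-[\mu_Y,\eta_X]$. $d^\nabla$ is the exterior derivative on endomorphism-valued forms. An isomorphism $(\underline{\mathbb{C}}^{n+2},\nabla)\to(\underline{\mathbb{C}}^{n+2},\nabla')$ of bundles with metric and connection is a bundle isometry $\phi$ with $\phi\circ\nabla=\nabla'\circ\phi$. For a non-degenerate subbundle $V\subset\underline{\mathbb{C}}^{n+2}$: $\mathcal{D}_V:=\pi_V\circ d\circ\pi_V+\pi_{V^\perp}\circ d\circ\pi_{V^\perp}$, $\mathcal{N}_V:=d-\mathcal{D}_V$, and for a $1$-form $q$ with values in $\wedge^2V\oplus\wedge^2V^\perp$ and $\lambda\in\mathbb{C}\backslash\{0\}$, $d^{\lambda,q}_V:=\mathcal{D}_V+\lambda^{-1}\mathcal{N}_V^{1,0}+\lambda\mathcal{N}_V^{0,1}+(\lambda^{-2}-1)q^{1,0}+(\lambda^2-1)q^{0,1}$.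 $V$ is $q$-constrained harmonic if $d^{\mathcal{D}_V}q^{1,0}=\frac12[q\wedge q]=d^{\mathcal{D}_V}q^{0,1}$ and $d^{\mathcal{D}_V}*\mathcal{N}_V=2[q\wedge*\mathcal{N}_V]$; this makes $d^{\lambda,q}_V$ flat for all $\lambda$. A (complexified) surface is a pair $(\Delta^{1,0},\Delta^{0,1})$ of isotropic rank $2$ subbundles of $\underline{\mathbb{C}}^{n+2}$ intersecting in a rank $1$ bundle $\Delta=\Delta^{1,0}\cap\Delta^{0,1}$ with $d^{1,0}\Gamma(\Delta)\subset\Omega^{1,0}(\Delta^{1,0})$ and $d^{0,1}\Gamma(\Delta)\subset\Omega^{0,1}(\Delta^{0,1})$. A central sphere congruence of it is a non-degenerate rank $4$ subbundle $V\supset\Delta^{1,0}+\Delta^{0,1}$ with $\mathcal{N}_V^{1,0}\Delta^{0,1}=0=\mathcal{N}_V^{0,1}\Delta^{1,0}$. The pair is a $q$-constrained Willmore surface, $q=q^{1,0}+q^{0,1}$, if $q^{1,0}\in\Omega^{1,0}(\wedge^2\Delta^{0,1})$, $q^{0,1}\in\Omega^{0,1}(\wedge^2\Delta^{1,0})$ and it admits a $q$-constrained harmonic central sphere congruence $V$; such a $V$ is called a $(q,d)$-central sphere congruence. *)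

theory Defs
  imports "HOL-Analysis.Analysis"
begin

section \<open>Smooth functions and Riemann surfaces\<close>

fun times_differentiable_on ::
  "nat \<Rightarrow> ('a::real_normed_vector \<Rightarrow> 'b::real_normed_vector) \<Rightarrow> 'a set \<Rightarrow> bool" where
  "times_differentiable_on 0 f S \<longleftrightarrow> continuous_on S f"
| "times_differentiable_on (Suc k) f S \<longleftrightarrow>
     (\<forall>x\<in>S. f differentiable (at x)) \<and>
     (\<forall>v. times_differentiable_on k (\<lambda>x. frechet_derivative f (at x) v) S)"

text \<open>Real \<open>C\<^sup>\<infinity>\<close> smoothness; only used for open \<open>S\<close>.\<close>

definition smooth_on ::
  "'a::real_normed_vector set \<Rightarrow> ('a \<Rightarrow> 'b::real_normed_vector) \<Rightarrow> bool" where
  "smooth_on S f \<longleftrightarrow> (\<forall>k. times_differentiable_on k f S)"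

type_synonym 'm chart = "'m set \<times> ('m \<Rightarrow> complex)"

definition chart_inv :: "'m chart \<Rightarrow> complex \<Rightarrow> 'm" where
  "chart_inv c = inv_into (fst c) (snd c)"

text \<open>An oriented surface with a conformal structure is a surface \<open>M\<close> with an atlas \<open>A\<close> of oriented
  conformal (that is, holomorphic) coordinates.  In such a coordinate the induced complex structure
  \<open>J\<close> is multiplication by \<open>\<i>\<close> on the tangent space \<open>\<complex> = \<real>\<^sup>2\<close>.\<close>

definition riemann_surface ::
  "'m::{t2_space,second_countable_topology} set \<Rightarrow> 'm chart set \<Rightarrow> bool" where
  "riemann_surface M A \<longleftrightarrow>
     open M \<and> (\<Union>c\<in>A. fst c) = M \<and>
     (\<forall>c\<in>A. open (fst c) \<and> open (snd c ` fst c) \<and>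
        homeomorphism (fst c) (snd c ` fst c) (snd c) (chart_inv c)) \<and>
     (\<forall>c\<in>A. \<forall>c'\<in>A. (snd c' \<circ> chart_inv c) holomorphic_on (snd c ` (fst c \<inter> fst c')))"

definition msmooth ::
  "'m chart set \<Rightarrow> 'm set \<Rightarrow> ('m \<Rightarrow> 'b::real_normed_vector) \<Rightarrow> bool" where
  "msmooth A W f \<longleftrightarrow> (\<forall>c\<in>A. smooth_on (snd c ` (fst c \<inter> W)) (f \<circ> chart_inv c))"


section \<open>One-forms\<close>

text \<open>A one-form is given by its local representatives: \<open>\<omega> c p X\<close> is the value of \<open>\<omega>\<close> on the tangent
  vector at \<open>p\<close> with coordinates \<open>X\<close> in the chart \<open>c\<close>.  It is real linear in \<open>X\<close>, even though its
  values lie in complex vector spaces.\<close>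

type_synonym ('m, 'b) form = "'m chart \<Rightarrow> 'm \<Rightarrow> complex \<Rightarrow> 'b"

definition one_form :: "'m chart set \<Rightarrow> ('m, 'b::real_normed_vector) form \<Rightarrow> bool" where
  "one_form A \<omega> \<longleftrightarrow>
     (\<forall>c\<in>A. \<forall>p\<in>fst c. linear (\<omega> c p)) \<and>
     (\<forall>c\<in>A. \<forall>X. smooth_on (snd c ` fst c) (\<lambda>z. \<omega> c (chart_inv c z) X)) \<and>
     (\<forall>c\<in>A. \<forall>c'\<in>A. \<forall>p\<in>fst c \<inter> fst c'. \<forall>X.
        \<omega> c p X = \<omega> c' p (deriv (snd c' \<circ> chart_inv c) (snd c p) * X))"

definition values_in :: "'m chart set \<Rightarrow> ('m, 'b) form \<Rightarrow> ('m \<Rightarrow> 'b set) \<Rightarrow> bool" where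
  "values_in A \<omega> E \<longleftrightarrow> (\<forall>c\<in>A. \<forall>p\<in>fst c. \<forall>X. \<omega> c p X \<in> E p)"

text \<open>\<open>(*s)\<close> is the complex scaling of vectors, \<open>mscale\<close> that of matrices.  The \<open>(1,0)\<close>-part of
  \<open>\<omega>\<close> is \<open>(\<omega> - \<i> \<omega> \<circ> J) / 2\<close>; the scaling is passed as the argument \<open>sc\<close>.\<close>

definition mscale :: "complex \<Rightarrow> complex^'n^'n \<Rightarrow> complex^'n^'n" where
  "mscale a = map_matrix ((*) a)"

definition form10 :: "(complex \<Rightarrow> 'b \<Rightarrow> 'b::ab_group_add) \<Rightarrow> ('m, 'b) form \<Rightarrow> ('m, 'b) form" where
  "form10 sc \<omega> c p X = sc (1/2) (\<omega> c p X - sc \<i> (\<omega> c p (\<i> * X)))"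

definition form01 :: "(complex \<Rightarrow> 'b \<Rightarrow> 'b::ab_group_add) \<Rightarrow> ('m, 'b) form \<Rightarrow> ('m, 'b) form" where
  "form01 sc \<omega> c p X = sc (1/2) (\<omega> c p X + sc \<i> (\<omega> c p (\<i> * X)))"

definition form_star :: "('m, 'b::ab_group_add) form \<Rightarrow> ('m, 'b) form" where
  "form_star \<omega> c p X = - \<omega> c p (\<i> * X)"

definition lie_bracket :: "complex^'n^'n \<Rightarrow> complex^'n^'n \<Rightarrow> complex^'n^'n" where
  "lie_bracket S T = S ** T - T ** S"

definition bracket_wedge ::
  "('m, complex^'n^'n) form \<Rightarrow> ('m, complex^'n^'n) form \<Rightarrow>
   'm chart \<Rightarrow> 'm \<Rightarrow> complex \<Rightarrow> complex \<Rightarrow> complex^'n^'n" where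
  "bracket_wedge \<mu> \<eta> c p X Y =
     lie_bracket (\<mu> c p X) (\<eta> c p Y) - lie_bracket (\<mu> c p Y) (\<eta> c p X)"


section \<open>Complexified Minkowski space\<close>

text \<open>For \<open>CARD('k) = n + 1\<close>, \<open>'a ^ 'k option\<close> is \<open>\<real>\<^sup>n\<^sup>+\<^sup>1\<^sup>,\<^sup>1\<close> (\<open>'a = real\<close>) or its complexification
  (\<open>'a = complex\<close>), with timelike coordinate \<open>None\<close>.  The formula is complex bilinear (not
  sesquilinear) over \<open>\<complex>\<close>.\<close>

definition mink :: "'a::comm_ring_1 ^ 'k::finite option \<Rightarrow> 'a ^ 'k option \<Rightarrow> 'a" where
  "mink v w = (\<Sum>i\<in>UNIV. v $ Some i * w $ Some i) - v $ None * w $ None"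

type_synonym 'k cvec = "complex ^ 'k option"
type_synonym 'k cmat = "complex ^ 'k option ^ 'k option"

definition orth :: "'k::finite cvec set \<Rightarrow> 'k cvec set" where
  "orth S = {v. \<forall>w\<in>S. mink v w = 0}"

definition nondegenerate :: "'k::finite cvec set \<Rightarrow> bool" where
  "nondegenerate S \<longleftrightarrow> S \<inter> orth S = {0}"

definition isotropic :: "'k::finite cvec set \<Rightarrow> bool" where
  "isotropic S \<longleftrightarrow> (\<forall>v\<in>S. \<forall>w\<in>S. mink v w = 0)"

text \<open>Orthogonal projection onto a non-degenerate subspace.\<close>

definition proj :: "'k::finite cvec set \<Rightarrow> 'k cvec \<Rightarrow> 'k cvec" where
  "proj S v = (THE u. u \<in> S \<and> v - u \<in> orth S)"

text \<open>Bivectors as skew endomorphisms.\<close>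

definition wedge :: "'k::finite cvec \<Rightarrow> 'k cvec \<Rightarrow> 'k cmat" where
  "wedge v1 v2 = matrix (\<lambda>w. mink w v1 *s v2 - mink w v2 *s v1)"

text \<open>\<open>span\<close> is the real span; for a complex subspace \<open>S\<close> the generators are closed under complex
  scaling, so this is also the complex span.\<close>

definition wedge2 :: "'k::finite cvec set \<Rightarrow> 'k cmat set" where
  "wedge2 S = span {wedge v w |v w. v \<in> S \<and> w \<in> S}"


section \<open>Subbundles of the trivial bundle\<close>

definition subbundle ::
  "'m::topological_space set \<Rightarrow> 'm chart set \<Rightarrow> nat \<Rightarrow> ('m \<Rightarrow> 'k::finite cvec set) \<Rightarrow> bool" where
  "subbundle M A r E \<longleftrightarrow>
     (\<forall>p\<in>M. vec.subspace (E p) \<and> vec.dim (E p) = r) \<and>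
     (\<forall>p\<in>M. \<exists>W s. open W \<and> p \<in> W \<and> W \<subseteq> M \<and> (\<forall>i<r. msmooth A W (s i)) \<and>
        (\<forall>x\<in>W. E x = vec.span ((\<lambda>i::nat. s i x) ` {..<r})))"

definition sections ::
  "'m set \<Rightarrow> 'm chart set \<Rightarrow> ('m \<Rightarrow> 'k::finite cvec set) \<Rightarrow> ('m \<Rightarrow> 'k cvec) set" where
  "sections M A E = {\<sigma>. msmooth A M \<sigma> \<and> (\<forall>p\<in>M. \<sigma> p \<in> E p)}"

definition nondegenerate_subbundle ::
  "'m::topological_space set \<Rightarrow> 'm chart set \<Rightarrow> nat \<Rightarrow> ('m \<Rightarrow> 'k::finite cvec set) \<Rightarrow> bool" where
  "nondegenerate_subbundle M A r V \<longleftrightarrow> subbundle M A r V \<and> (\<forall>p\<in>M. nondegenerate (V p))"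


section \<open>Connections\<close>

text \<open>A connection maps a section to a vector-valued one-form.\<close>

type_synonym ('m, 'k) conn = "('m \<Rightarrow> 'k cvec) \<Rightarrow> ('m, 'k cvec) form"

definition dtriv :: "('m, 'k::finite) conn" where
  "dtriv \<sigma> c p X = frechet_derivative (\<sigma> \<circ> chart_inv c) (at (snd c p)) X"

definition DV :: "('m \<Rightarrow> 'k::finite cvec set) \<Rightarrow> ('m, 'k) conn" where
  "DV V \<sigma> c p X =
     proj (V p) (dtriv (\<lambda>x. proj (V x) (\<sigma> x)) c p X)
     + proj (orth (V p)) (dtriv (\<lambda>x. proj (orth (V x)) (\<sigma> x)) c p X)"

text \<open>\<open>d - \<D>\<^sub>V\<close> is tensorial; its value on a vector is computed on the constant extension.\<close>

definition NV :: "('m \<Rightarrow> 'k::finite cvec set) \<Rightarrow> ('m, 'k cmat) form" where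
  "NV V c p X = matrix (\<lambda>v. dtriv (\<lambda>_. v) c p X - DV V (\<lambda>_. v) c p X)"

text \<open>Exterior derivative of an endomorphism-valued one-form, for the connection induced on
  endomorphisms by \<open>(\<nabla>\<xi>)\<sigma> = \<nabla>(\<xi>\<sigma>) - \<xi>(\<nabla>\<sigma>)\<close>.  It is evaluated on coordinate vector fields with
  constant coefficients \<open>X\<close>, \<open>Y\<close>; these commute, so the term in \<open>[X, Y]\<close> drops out.\<close>

definition endo_deriv ::
  "('m, 'k::finite) conn \<Rightarrow> ('m \<Rightarrow> 'k cmat) \<Rightarrow> ('m, 'k cmat) form" where
  "endo_deriv D \<xi> c p X = matrix (\<lambda>v. D (\<lambda>x. \<xi> x *v v) c p X - \<xi> p *v D (\<lambda>_. v) c p X)"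

definition ext_deriv ::
  "('m, 'k::finite) conn \<Rightarrow> ('m, 'k cmat) form \<Rightarrow>
   'm chart \<Rightarrow> 'm \<Rightarrow> complex \<Rightarrow> complex \<Rightarrow> 'k cmat" where
  "ext_deriv D \<omega> c p X Y =
     endo_deriv D (\<lambda>x. \<omega> c x Y) c p X - endo_deriv D (\<lambda>x. \<omega> c x X) c p Y"

definition dlam ::
  "complex \<Rightarrow> ('m, 'k::finite cmat) form \<Rightarrow> ('m \<Rightarrow> 'k cvec set) \<Rightarrow> ('m, 'k) conn" where
  "dlam l q V \<sigma> c p X =
     DV V \<sigma> c p X
     + inverse l *s (form10 mscale (NV V) c p X *v \<sigma> p)
     + l *s (form01 mscale (NV V) c p X *v \<sigma> p)
     + (inverse l ^ 2 - 1) *s (form10 mscale q c p X *v \<sigma> p)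
     + (l ^ 2 - 1) *s (form01 mscale q c p X *v \<sigma> p)"

definition bundle_isomorphism ::
  "'m set \<Rightarrow> 'm chart set \<Rightarrow> ('m, 'k::finite) conn \<Rightarrow> ('m, 'k) conn \<Rightarrow> ('m \<Rightarrow> 'k cmat) \<Rightarrow> bool" where
  "bundle_isomorphism M A D D' \<phi> \<longleftrightarrow>
     msmooth A M \<phi> \<and>
     (\<forall>p\<in>M. invertible (\<phi> p) \<and> (\<forall>v w. mink (\<phi> p *v v) (\<phi> p *v w) = mink v w)) \<and>
     (\<forall>\<sigma>\<in>sections M A (\<lambda>_. UNIV). \<forall>c\<in>A. \<forall>p\<in>fst c. \<forall>X.
        \<phi> p *v D \<sigma> c p X = D' (\<lambda>x. \<phi> x *v \<sigma> x) c p X)"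


section \<open>Constrained harmonic bundles and constrained Willmore surfaces\<close>

definition constrained_harmonic ::
  "'m::topological_space set \<Rightarrow> 'm chart set \<Rightarrow> ('m, 'k::finite cmat) form \<Rightarrow>
   ('m \<Rightarrow> 'k cvec set) \<Rightarrow> bool" where
  "constrained_harmonic M A q V \<longleftrightarrow>
     (\<exists>r. nondegenerate_subbundle M A r V) \<and>
     one_form A q \<and>
     values_in A q (\<lambda>p. {S + T |S T. S \<in> wedge2 (V p) \<and> T \<in> wedge2 (orth (V p))}) \<and>
     (\<forall>c\<in>A. \<forall>p\<in>fst c. \<forall>X Y.
        ext_deriv (DV V) (form10 mscale q) c p X Y = mscale (1/2) (bracket_wedge q q c p X Y) \<and>
        ext_deriv (DV V) (form01 mscale q) c p X Y = mscale (1/2) (bracket_wedge q q c p X Y) \<and>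
        ext_deriv (DV V) (form_star (NV V)) c p X Y
          = mscale 2 (bracket_wedge q (form_star (NV V)) c p X Y))"

definition complexified_surface ::
  "'m::topological_space set \<Rightarrow> 'm chart set \<Rightarrow>
   ('m \<Rightarrow> 'k::finite cvec set) \<Rightarrow> ('m \<Rightarrow> 'k cvec set) \<Rightarrow> bool" where
  "complexified_surface M A \<Delta>10 \<Delta>01 \<longleftrightarrow>
     subbundle M A 2 \<Delta>10 \<and> subbundle M A 2 \<Delta>01 \<and>
     (\<forall>p\<in>M. isotropic (\<Delta>10 p) \<and> isotropic (\<Delta>01 p)) \<and>
     subbundle M A 1 (\<lambda>p. \<Delta>10 p \<inter> \<Delta>01 p) \<and>
     (\<forall>\<sigma>\<in>sections M A (\<lambda>p. \<Delta>10 p \<inter> \<Delta>01 p).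
        values_in A (form10 (*s) (dtriv \<sigma>)) \<Delta>10 \<and>
        values_in A (form01 (*s) (dtriv \<sigma>)) \<Delta>01)"

definition central_sphere_congruence ::
  "'m::topological_space set \<Rightarrow> 'm chart set \<Rightarrow>
   ('m \<Rightarrow> 'k::finite cvec set) \<Rightarrow> ('m \<Rightarrow> 'k cvec set) \<Rightarrow> ('m \<Rightarrow> 'k cvec set) \<Rightarrow> bool" where
  "central_sphere_congruence M A \<Delta>10 \<Delta>01 V \<longleftrightarrow>
     nondegenerate_subbundle M A 4 V \<and>
     (\<forall>p\<in>M. {u + v |u v. u \<in> \<Delta>10 p \<and> v \<in> \<Delta>01 p} \<subseteq> V p) \<and>
     (\<forall>c\<in>A. \<forall>p\<in>fst c. \<forall>X.
        (\<forall>v\<in>\<Delta>01 p. form10 mscale (NV V) c p X *v v = 0) \<and>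
        (\<forall>v\<in>\<Delta>10 p. form01 mscale (NV V) c p X *v v = 0))"

definition q_central_sphere_congruence ::
  "'m::topological_space set \<Rightarrow> 'm chart set \<Rightarrow> ('m, 'k::finite cmat) form \<Rightarrow>
   ('m \<Rightarrow> 'k cvec set) \<Rightarrow> ('m \<Rightarrow> 'k cvec set) \<Rightarrow> ('m \<Rightarrow> 'k cvec set) \<Rightarrow> bool" where
  "q_central_sphere_congruence M A q \<Delta>10 \<Delta>01 V \<longleftrightarrow>
     central_sphere_congruence M A \<Delta>10 \<Delta>01 V \<and> constrained_harmonic M A q V"

definition constrained_willmore ::
  "'m::topological_space set \<Rightarrow> 'm chart set \<Rightarrow> ('m, 'k::finite cmat) form \<Rightarrow>
   ('m \<Rightarrow> 'k cvec set) \<Rightarrow> ('m \<Rightarrow> 'k cvec set) \<Rightarrow> bool" where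
  "constrained_willmore M A q \<Delta>10 \<Delta>01 \<longleftrightarrow>
     complexified_surface M A \<Delta>10 \<Delta>01 \<and>
     one_form A q \<and>
     values_in A (form10 mscale q) (\<lambda>p. wedge2 (\<Delta>01 p)) \<and>
     values_in A (form01 mscale q) (\<lambda>p. wedge2 (\<Delta>10 p)) \<and>
     (\<exists>V. q_central_sphere_congruence M A q \<Delta>10 \<Delta>01 V)"

definition q_lam :: "complex \<Rightarrow> ('m, 'k::finite cmat) form \<Rightarrow> ('m, 'k cmat) form" where
  "q_lam l q c p X =
     mscale (inverse l ^ 2) (form10 mscale q c p X) + mscale (l ^ 2) (form01 mscale q c p X)"

definition Ad_form ::
  "('m \<Rightarrow> 'k::finite cmat) \<Rightarrow> ('m, 'k cmat) form \<Rightarrow> ('m, 'k cmat) form" where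
  "Ad_form \<phi> q c p X = \<phi> p ** q c p X ** matrix_inv (\<phi> p)"

definition bundle_image ::
  "('m \<Rightarrow> 'k::finite cmat) \<Rightarrow> ('m \<Rightarrow> 'k cvec set) \<Rightarrow> 'm \<Rightarrow> 'k cvec set" where
  "bundle_image \<phi> E p = (\<lambda>v. \<phi> p *v v) ` E p"

end

theory Submission
  imports Defs
begin

text \<open>
  Let \<open>P\<close> be the field of orthogonal projectors onto \<open>V\<close>.  Then \<open>\<N>\<^sub>V = [dP, P]\<close> and
  \<open>\<D>\<^sub>V = d - \<N>\<^sub>V\<close>, and the isomorphism \<open>g = \<phi>\<^sup>\<lambda>\<^sub>q\<close> is a gauge transformation with
  \<open>B = g\<^sup>-\<^sup>1 dg = (\<lambda>\<^sup>-\<^sup>1 - 1) \<N>\<^sup>1\<^sup>,\<^sup>0 + (\<lambda> - 1) \<N>\<^sup>0\<^sup>,\<^sup>1 + R\<close>, where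
  \<open>R = (\<lambda>\<^sup>-\<^sup>2 - 1) q\<^sup>1\<^sup>,\<^sup>0 + (\<lambda>\<^sup>2 - 1) q\<^sup>0\<^sup>,\<^sup>1\<close>.  The part of \<open>B\<close> that does not commute with \<open>P\<close>
  is the one made of \<open>\<N>\<close>, so \<open>\<N>\<close> of \<open>gV\<close> is the conjugate by \<open>g\<close> of
  \<open>\<lambda>\<^sup>-\<^sup>1 \<N>\<^sup>1\<^sup>,\<^sup>0 + \<lambda> \<N>\<^sup>0\<^sup>,\<^sup>1\<close>, and the exterior derivative for \<open>gV\<close> of the conjugate of \<open>\<omega>\<close> is
  the conjugate of that of \<open>\<omega>\<close> for \<open>V\<close> plus \<open>[R \<and> \<omega>]\<close>.  With the identity
  \<open>d\<^sup>\<D> \<N> = 0\<close> (symmetry of the second derivatives of \<open>P\<close>), the equations for \<open>gV\<close> reduce to those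
  for \<open>V\<close> by sorting powers of \<open>\<lambda>\<close>.  Finally \<open>B\<^sup>1\<^sup>,\<^sup>0\<close> and \<open>B\<^sup>0\<^sup>,\<^sup>1\<close> annihilate
  \<open>\<Delta>\<close>, because \<open>\<Delta>\<^sup>1\<^sup>,\<^sup>0\<close> and \<open>\<Delta>\<^sup>0\<^sup>,\<^sup>1\<close> are isotropic; so \<open>g\<close> maps surfaces to surfaces.
\<close>

section \<open>Smooth functions\<close>

lemma times_differentiable_on_cong:
  assumes "open S" and "\<And>x. x \<in> S \<Longrightarrow> f x = g x" and "times_differentiable_on k f S"
  shows "times_differentiable_on k g S"
  using assms
proof (induction k arbitrary: f g)
  case 0
  then show ?case by (auto cong: continuous_on_cong)
next
  case (Suc k)
  \<comment> \<open>A derivative sees a whole neighbourhood, so agreement of \<open>f\<close> and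
    \<open>g\<close> on \<open>S\<close> passes to derivatives because \<open>S\<close> is
    open.\<close>
  have d: "(g has_derivative frechet_derivative f (at x)) (at x)" if "x \<in> S" for x
  proof -
    have "(f has_derivative frechet_derivative f (at x)) (at x)"
      using Suc.prems(3) that frechet_derivative_works by auto
    then show ?thesis
      by (rule has_derivative_transform_within_open[OF _ Suc.prems(1) that]) (use Suc.prems(2) in auto)
  qed
  show ?case
    unfolding times_differentiable_on.simps
  proof (intro conjI ballI allI)
    show "g differentiable (at x)" if "x \<in> S" for x
      using d[OF that] by (auto simp: differentiable_def)
    show "times_differentiable_on k (\<lambda>x. frechet_derivative g (at x) v) S" for v
    proof (rule Suc.IH[OF Suc.prems(1)])
      show "frechet_derivative f (at x) v = frechet_derivative g (at x) v" if "x \<in> S" for x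
        using frechet_derivative_at[OF d[OF that]] by simp
      show "times_differentiable_on k (\<lambda>x. frechet_derivative f (at x) v) S"
        using Suc.prems(3) by simp
    qed
  qed
qed

text \<open>An explicit derivative \<open>f'\<close> may stand in for the operator
  \<open>frechet_derivative\<close>; the closure lemmas feed in the usual differentiation rules and
  run their induction on \<open>f'\<close>.\<close>

lemma times_differentiable_on_SucI:
  assumes "open S" and "\<And>x. x \<in> S \<Longrightarrow> (f has_derivative f' x) (at x)"
    and "\<And>v. times_differentiable_on k (\<lambda>x. f' x v) S"
  shows "times_differentiable_on (Suc k) f S"
  unfolding times_differentiable_on.simps
proof (intro conjI ballI allI)
  show "f differentiable (at x)" if "x \<in> S" for x
    using assms(2)[OF that] by (auto simp: differentiable_def)
  show "times_differentiable_on k (\<lambda>x. frechet_derivative f (at x) v) S" for v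
    by (rule times_differentiable_on_cong[OF assms(1) _ assms(3)])
       (use frechet_derivative_at[OF assms(2)] in force)
qed

lemma times_differentiable_on_SucD:
  assumes "times_differentiable_on (Suc k) f S"
  shows "x \<in> S \<Longrightarrow> (f has_derivative frechet_derivative f (at x)) (at x)"
    and "times_differentiable_on k (\<lambda>x. frechet_derivative f (at x) v) S"
  using assms frechet_derivative_works by auto

lemma times_differentiable_on_lower:
  "times_differentiable_on (Suc k) f S \<Longrightarrow> times_differentiable_on k f S"
proof (induction k arbitrary: f)
  case 0
  then show ?case
    by (auto intro!: continuous_at_imp_continuous_on differentiable_imp_continuous_within)
next
  case (Suc k)
  then show ?case by (metis times_differentiable_on.simps(2))
qed

lemma times_differentiable_on_const: "times_differentiable_on k (\<lambda>_. c) S"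
  by (induction k arbitrary: c) auto

lemma times_differentiable_on_bounded_linear:
  assumes "bounded_linear h" "open S" "times_differentiable_on k f S"
  shows "times_differentiable_on k (\<lambda>x. h (f x)) S"
  using assms
proof (induction k arbitrary: f)
  case 0
  then show ?case by (auto intro: bounded_linear.continuous_on)
next
  case (Suc k)
  show ?case
    by (rule times_differentiable_on_SucI[OF Suc.prems(2)
          bounded_linear.has_derivative[OF Suc.prems(1)]])
      (use Suc times_differentiable_on_SucD in blast)+
qed

lemma times_differentiable_on_add:
  assumes "open S" "times_differentiable_on k f S" "times_differentiable_on k g S"
  shows "times_differentiable_on k (\<lambda>x. f x + g x) S"
  using assms
proof (induction k arbitrary: f g)
  case 0
  then show ?case by (auto intro: continuous_on_add)
next
  case (Suc k)
  show ?case
    by (rule times_differentiable_on_SucI[OF Suc.prems(1) has_derivative_add])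
      (use Suc times_differentiable_on_SucD in blast)+
qed

text \<open>The product rule gives two bilinear expressions; in each, one factor stays
  undifferentiated and is used with one order of differentiability less, so the induction hypothesis
  applies to both.\<close>

lemma times_differentiable_on_bilinear:
  assumes "bounded_bilinear h" "open S" "times_differentiable_on k f S" "times_differentiable_on k g S"
  shows "times_differentiable_on k (\<lambda>x. h (f x) (g x)) S"
  using assms
proof (induction k arbitrary: f g)
  case 0
  then show ?case by (auto intro: bounded_bilinear.continuous_on)
next
  case (Suc k)
  show ?case
  proof (rule times_differentiable_on_SucI[OF Suc.prems(2)])
    show "((\<lambda>x. h (f x) (g x)) has_derivative
        (\<lambda>v. h (f x) (frechet_derivative g (at x) v) + h (frechet_derivative f (at x) v) (g x))) (at x)"
      if "x \<in> S" for x
      by (rule bounded_bilinear.FDERIV[OF Suc.prems(1)])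
        (use Suc.prems(3,4) that times_differentiable_on_SucD(1) in blast)+
    show "times_differentiable_on k
        (\<lambda>x. h (f x) (frechet_derivative g (at x) v) + h (frechet_derivative f (at x) v) (g x)) S" for v
      by (intro times_differentiable_on_add Suc.IH[OF Suc.prems(1)] Suc.prems(2)
          times_differentiable_on_lower[OF Suc.prems(3)] times_differentiable_on_lower[OF Suc.prems(4)]
          times_differentiable_on_SucD(2)[OF Suc.prems(3)] times_differentiable_on_SucD(2)[OF Suc.prems(4)])
  qed
qed

text \<open>The derivative of the reciprocal contains the reciprocal again, but only at order
  \<open>k\<close>, where the induction hypothesis covers it.\<close>

lemma times_differentiable_on_inverse:
  fixes f :: "'a::real_normed_vector \<Rightarrow> complex"
  assumes "open S" "times_differentiable_on k f S" "\<And>x. x \<in> S \<Longrightarrow> f x \<noteq> 0"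
  shows "times_differentiable_on k (\<lambda>x. inverse (f x)) S"
  using assms
proof (induction k arbitrary: f)
  case 0
  then show ?case by (auto intro: continuous_on_inverse)
next
  case (Suc k)
  have inv: "times_differentiable_on k (\<lambda>x. inverse (f x)) S"
    using Suc times_differentiable_on_lower by blast
  show ?case
  proof (rule times_differentiable_on_SucI[OF Suc.prems(1)])
    show "((\<lambda>x. inverse (f x)) has_derivative
        (\<lambda>v. - (inverse (f x) * frechet_derivative f (at x) v * inverse (f x)))) (at x)"
      if "x \<in> S" for x
      using Deriv.has_derivative_inverse[OF Suc.prems(3)[OF that]
          times_differentiable_on_SucD(1)[OF Suc.prems(2) that]] .
    show "times_differentiable_on k
        (\<lambda>x. - (inverse (f x) * frechet_derivative f (at x) v * inverse (f x))) S" for v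
      by (intro times_differentiable_on_bounded_linear[OF bounded_linear_minus[OF bounded_linear_ident]]
          times_differentiable_on_bilinear[OF bounded_bilinear_mult] inv
          times_differentiable_on_SucD(2)[OF Suc.prems(2)] Suc.prems(1))
  qed
qed

lemma smooth_on_cong:
  "open S \<Longrightarrow> (\<And>x. x \<in> S \<Longrightarrow> f x = g x) \<Longrightarrow> smooth_on S f \<Longrightarrow> smooth_on S g"
  unfolding smooth_on_def using times_differentiable_on_cong by blast

lemma smooth_on_const: "smooth_on S (\<lambda>_. c)"
  unfolding smooth_on_def using times_differentiable_on_const by blast

lemma smooth_on_if:
  "smooth_on S f \<Longrightarrow> smooth_on S g \<Longrightarrow> smooth_on S (\<lambda>x. if b then f x else g x)"
  by (cases b) simp_all

lemma smooth_on_linear: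
  fixes h :: "'b::euclidean_space \<Rightarrow> 'c::euclidean_space"
  shows "linear h \<Longrightarrow> open S \<Longrightarrow> smooth_on S f \<Longrightarrow> smooth_on S (\<lambda>x. h (f x))"
  unfolding smooth_on_def linear_conv_bounded_linear
  using times_differentiable_on_bounded_linear by blast

lemma smooth_on_add:
  "open S \<Longrightarrow> smooth_on S f \<Longrightarrow> smooth_on S g \<Longrightarrow> smooth_on S (\<lambda>x. f x + g x)"
  unfolding smooth_on_def using times_differentiable_on_add by blast

lemma smooth_on_bilinear:
  assumes "bounded_bilinear h" "open S" "smooth_on S f" "smooth_on S g"
  shows "smooth_on S (\<lambda>x. h (f x) (g x))"
  using assms times_differentiable_on_bilinear unfolding smooth_on_def by blast

lemma smooth_on_uminus: "open S \<Longrightarrow> smooth_on S f \<Longrightarrow> smooth_on S (\<lambda>x. - f x)"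
  unfolding smooth_on_def
  using times_differentiable_on_bounded_linear[OF bounded_linear_minus[OF bounded_linear_ident]] by blast

lemma smooth_on_diff:
  "open S \<Longrightarrow> smooth_on S f \<Longrightarrow> smooth_on S g \<Longrightarrow> smooth_on S (\<lambda>x. f x - g x)"
  using smooth_on_add[of S f "\<lambda>x. - g x"] smooth_on_uminus[of S g] by simp

lemma smooth_on_sum:
  assumes "open S" "\<And>i. i \<in> I \<Longrightarrow> smooth_on S (f i)"
  shows "smooth_on S (\<lambda>x. \<Sum>i\<in>I. f i x)"
  using assms(2)
proof (induction I rule: infinite_finite_induct)
  case (insert a F)
  then show ?case by (simp add: smooth_on_add assms(1))
qed (auto simp: smooth_on_const)

lemma smooth_on_prod:
  fixes f :: "'i \<Rightarrow> 'a::real_normed_vector \<Rightarrow> complex"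
  assumes "open S" "\<And>i. i \<in> I \<Longrightarrow> smooth_on S (f i)"
  shows "smooth_on S (\<lambda>x. \<Prod>i\<in>I. f i x)"
  using assms(2)
proof (induction I rule: infinite_finite_induct)
  case (insert a F)
  then show ?case by (simp add: smooth_on_bilinear[OF bounded_bilinear_mult] assms(1))
qed (auto simp: smooth_on_const)

lemma smooth_on_inverse:
  fixes f :: "'a::real_normed_vector \<Rightarrow> complex"
  shows "open S \<Longrightarrow> smooth_on S f \<Longrightarrow> (\<And>x. x \<in> S \<Longrightarrow> f x \<noteq> 0) \<Longrightarrow> smooth_on S (\<lambda>x. inverse (f x))"
  unfolding smooth_on_def using times_differentiable_on_inverse by blast

lemma smooth_on_has_derivative:
  "smooth_on S f \<Longrightarrow> x \<in> S \<Longrightarrow> (f has_derivative frechet_derivative f (at x)) (at x)"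
  unfolding smooth_on_def using times_differentiable_on_SucD(1) by blast

lemma smooth_on_frechet_derivative:
  "smooth_on S f \<Longrightarrow> smooth_on S (\<lambda>x. frechet_derivative f (at x) v)"
  unfolding smooth_on_def using times_differentiable_on_SucD(2) by blast

lemma smooth_on_imp_continuous_on: "smooth_on S f \<Longrightarrow> continuous_on S f"
  unfolding smooth_on_def using times_differentiable_on.simps(1) by blast

text \<open>Continuity and derivatives depend on germs only. This serves the projectors onto a
  subbundle, for which an explicit smooth formula exists only near a point with a local
  frame.\<close>

lemma smooth_on_local:
  assumes "\<And>x. x \<in> S \<Longrightarrow> \<exists>U. open U \<and> x \<in> U \<and> smooth_on U f"
  shows "smooth_on S f"
proof -
  \<comment> \<open>The claim is made for each order separately and for all \<open>g\<close>, so
    that the induction can pass to directional derivatives.\<close>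
  have "times_differentiable_on k g S"
    if "\<And>x. x \<in> S \<Longrightarrow> \<exists>U. open U \<and> x \<in> U \<and> times_differentiable_on k g U"
    for k and g :: "'a \<Rightarrow> 'b"
    using that
  proof (induction k arbitrary: g)
    case 0
    show ?case
      unfolding times_differentiable_on.simps
    proof (rule continuous_at_imp_continuous_on, rule ballI)
      fix x assume "x \<in> S"
      then show "isCont g x" using 0 by (metis times_differentiable_on.simps(1) continuous_on_eq_continuous_at)
    qed
  next
    case (Suc k)
    show ?case
      unfolding times_differentiable_on.simps
    proof (intro conjI ballI allI)
      show "g differentiable (at x)" if "x \<in> S" for x
        using Suc.prems[OF that] by auto
      show "times_differentiable_on k (\<lambda>x. frechet_derivative g (at x) v) S" for v
        by (rule Suc.IH) (use Suc.prems in force)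
    qed
  qed
  then show ?thesis using assms unfolding smooth_on_def by metis
qed

lemma smooth_on_nth:
  fixes f :: "'a::real_normed_vector \<Rightarrow> 'b::euclidean_space^'n"
  shows "open S \<Longrightarrow> smooth_on S f \<Longrightarrow> smooth_on S (\<lambda>x. f x $ i)"
  by (rule smooth_on_linear[where h="\<lambda>v. v $ i"]) (auto intro: linearI)

lemma linear_axis: "linear (axis i :: 'b::real_vector \<Rightarrow> 'b^'n)"
  by (rule linearI) (auto simp: axis_def vec_eq_iff)

lemma smooth_on_vec:
  fixes f :: "'a::real_normed_vector \<Rightarrow> 'b::euclidean_space^'n"
  assumes "open S" "\<And>i. smooth_on S (\<lambda>x. f x $ i)"
  shows "smooth_on S f"
proof -
  have "smooth_on S (\<lambda>x. \<Sum>i\<in>UNIV. axis i (f x $ i))"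
    by (intro smooth_on_sum smooth_on_linear[OF linear_axis] assms)
  moreover have "(\<lambda>x. \<Sum>i\<in>UNIV. axis i (f x $ i)) = f"
    by (auto simp: fun_eq_iff vec_eq_iff axis_def)
  ultimately show ?thesis by simp
qed

lemma smooth_on_matrix:
  fixes f :: "'a::real_normed_vector \<Rightarrow> complex^'n^'m"
  assumes "open S" "\<And>i j. smooth_on S (\<lambda>x. f x $ i $ j)"
  shows "smooth_on S f"
  by (intro smooth_on_vec assms)

lemma bounded_bilinear_matrix_matrix_mult:
  "bounded_bilinear ((**) :: complex^'n^'m \<Rightarrow> complex^'p^'n \<Rightarrow> complex^'p^'m)"
  unfolding bilinear_conv_bounded_bilinear[symmetric] bilinear_def
  by (auto intro!: linearI simp: vec_eq_iff matrix_matrix_mult_def algebra_simps sum.distrib scaleR_sum_right)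

lemma bounded_bilinear_matrix_vector_mult:
  "bounded_bilinear ((*v) :: complex^'n^'m \<Rightarrow> complex^'n \<Rightarrow> complex^'m)"
  unfolding bilinear_conv_bounded_bilinear[symmetric] bilinear_def
  by (auto intro!: linearI simp: vec_eq_iff matrix_vector_mult_def algebra_simps sum.distrib scaleR_sum_right)

lemmas has_derivative_matrix_mult = bounded_bilinear.FDERIV[OF bounded_bilinear_matrix_matrix_mult]
lemmas has_derivative_matrix_vector_mult = bounded_bilinear.FDERIV[OF bounded_bilinear_matrix_vector_mult]
lemmas smooth_on_matrix_mult = smooth_on_bilinear[OF bounded_bilinear_matrix_matrix_mult]
lemmas smooth_on_matrix_vector_mult = smooth_on_bilinear[OF bounded_bilinear_matrix_vector_mult]

section \<open>Determinants and inverses of matrix-valued functions\<close>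

lemma smooth_on_det:
  fixes f :: "'a::real_normed_vector \<Rightarrow> complex^'n^'n"
  assumes "open S" "\<And>i j. smooth_on S (\<lambda>x. f x $ i $ j)"
  shows "smooth_on S (\<lambda>x. det (f x))"
  unfolding det_def
  by (rule smooth_on_sum[OF assms(1)], rule smooth_on_bilinear[OF bounded_bilinear_mult assms(1) smooth_on_const],
      rule smooth_on_prod[OF assms(1)], rule assms(2))

lemma matrix_inv_unique:
  fixes A B :: "'a::semiring_1^'n^'n"
  assumes "A ** B = mat 1" "B ** A = mat 1"
  shows "matrix_inv A = B"
proof -
  have "A ** matrix_inv A = mat 1 \<and> matrix_inv A ** A = mat 1"
    unfolding matrix_inv_def by (rule someI[of _ B]) (use assms in simp)
  then show ?thesis
    by (metis assms(2) matrix_mul_assoc matrix_mul_lid matrix_mul_rid)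
qed

lemma matrix_inv_cancel:
  fixes A :: "'a::semiring_1^'n^'n"
  assumes "invertible A"
  shows "A ** matrix_inv A = mat 1" "matrix_inv A ** A = mat 1"
proof -
  obtain B where "A ** B = mat 1" "B ** A = mat 1" using assms invertible_def by blast
  then show "A ** matrix_inv A = mat 1" "matrix_inv A ** A = mat 1"
    using matrix_inv_unique by metis+
qed

text \<open>Cramer's rule: column \<open>j\<close> of the inverse solves a linear system whose
  right-hand side is the \<open>j\<close>-th axis vector, so each entry is a quotient of two
  determinants.\<close>

lemma smooth_on_matrix_inv:
  fixes f :: "'a::real_normed_vector \<Rightarrow> complex^'n^'n"
  assumes "open S" "smooth_on S f" "\<And>x. x \<in> S \<Longrightarrow> invertible (f x)"
  shows "smooth_on S (\<lambda>x. matrix_inv (f x))"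
proof (rule smooth_on_matrix[OF assms(1)])
  fix i j
  have entries: "smooth_on S (\<lambda>x. f x $ k $ l)" for k l
    by (rule smooth_on_nth[OF assms(1) smooth_on_nth[OF assms(1,2)]])
  have cramer_entry: "det (\<chi> k l. if l = i then axis j 1 $ k else f x $ k $ l) * inverse (det (f x))
      = matrix_inv (f x) $ i $ j" if "x \<in> S" for x
  proof -
    have d: "det (f x) \<noteq> 0" using assms(3)[OF that] by (simp add: invertible_det_nz)
    have "f x *v (matrix_inv (f x) *v axis j 1) = axis j 1"
      by (simp add: matrix_vector_mul_assoc matrix_inv_cancel assms(3)[OF that])
    then have "matrix_inv (f x) *v axis j 1 =
        (\<chi> k. det (\<chi> m l. if l = k then axis j 1 $ m else f x $ m $ l) / det (f x))"
      using cramer[OF d] by blast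
    moreover have "(matrix_inv (f x) *v axis j 1) $ i = matrix_inv (f x) $ i $ j"
      by (simp add: matrix_vector_mult_def axis_def if_distrib cong: if_cong)
    ultimately show ?thesis by (simp add: divide_inverse)
  qed
  show "smooth_on S (\<lambda>x. matrix_inv (f x) $ i $ j)"
  proof (rule smooth_on_cong[OF assms(1) cramer_entry])
    show "smooth_on S (\<lambda>x. det (\<chi> k l. if l = i then axis j 1 $ k else f x $ k $ l) * inverse (det (f x)))"
    proof (rule smooth_on_bilinear[OF bounded_bilinear_mult assms(1)])
      show "smooth_on S (\<lambda>x. det (\<chi> k l. if l = i then axis j 1 $ k else f x $ k $ l))"
        \<comment> \<open>Which column is replaced does not depend on the point, hence
          \<open>smooth_on_if\<close>.\<close>
        by (rule smooth_on_det[OF assms(1)], simp, rule smooth_on_if) (rule smooth_on_const entries)+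
      show "smooth_on S (\<lambda>x. inverse (det (f x)))"
        using assms(3) entries
        by (intro smooth_on_inverse[OF assms(1)] smooth_on_det[OF assms(1)]) (auto simp: invertible_det_nz)
    qed
  qed auto
qed

section \<open>Symmetry of second derivatives\<close>

text \<open>The mean value theorem is used twice on a small parallelogram, first along
  \<open>X\<close>, then along \<open>Y\<close>; the ball in the hypothesis keeps the parallelogram
  inside \<open>S\<close>. The left-hand side is symmetric in \<open>X\<close> and \<open>Y\<close>,
  which is what the next lemma exploits.\<close>

lemma second_difference_mvt:
  fixes f :: "'a::real_normed_vector \<Rightarrow> real"
  assumes "open S" "smooth_on S f" "h > 0" "cball z (h * (norm X + norm Y)) \<subseteq> S"
  shows "\<exists>u. dist z u \<le> h * (norm X + norm Y) \<and>
    f (z + h *\<^sub>R X + h *\<^sub>R Y) - f (z + h *\<^sub>R X) - f (z + h *\<^sub>R Y) + f z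
      = h * h * frechet_derivative (\<lambda>w. frechet_derivative f (at w) X) (at u) Y"
proof -
  define d where "d = (\<lambda>w. frechet_derivative f (at w))"
  define dd where "dd = (\<lambda>w. frechet_derivative (\<lambda>w. d w X) (at w))"
  have inS: "z + s *\<^sub>R X + t *\<^sub>R Y \<in> S" "dist z (z + s *\<^sub>R X + t *\<^sub>R Y) \<le> h * (norm X + norm Y)"
    if "0 \<le> s" "s \<le> h" "0 \<le> t" "t \<le> h" for s t
  proof -
    have "norm (s *\<^sub>R X + t *\<^sub>R Y) \<le> h * norm X + h * norm Y"
      by (rule order_trans[OF norm_triangle_ineq]) (use that in \<open>auto intro!: add_mono mult_right_mono\<close>)
    then show "dist z (z + s *\<^sub>R X + t *\<^sub>R Y) \<le> h * (norm X + norm Y)"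
      by (subst dist_commute) (simp add: dist_norm add.assoc distrib_left)
    then show "z + s *\<^sub>R X + t *\<^sub>R Y \<in> S" using assms(4) by auto
  qed
  have fd: "(f has_derivative d w) (at w)" if "w \<in> S" for w
    unfolding d_def using smooth_on_has_derivative assms that by blast
  have dfd: "((\<lambda>w. d w X) has_derivative dd w) (at w)" if "w \<in> S" for w
    unfolding d_def dd_def
    using smooth_on_has_derivative[OF smooth_on_frechet_derivative[OF assms(2)] that] .
  have affX: "((\<lambda>s. z + s *\<^sub>R X + t *\<^sub>R Y) has_derivative (\<lambda>r. r *\<^sub>R X)) (at s within T)" for s t T
    by (auto intro!: derivative_eq_intros)
  have affY: "((\<lambda>t. z + s *\<^sub>R X + t *\<^sub>R Y) has_derivative (\<lambda>r. r *\<^sub>R Y)) (at t within T)" for s t T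
    by (auto intro!: derivative_eq_intros)
  \<comment> \<open>First use, along \<open>X\<close>, for the difference of \<open>f\<close>
    between two opposite sides. The factors \<open>0\<close> keep all four corners in the form that
    \<open>inS\<close> covers.\<close>
  have "\<exists>s\<in>{0<..<h}. (f (z + h *\<^sub>R X + h *\<^sub>R Y) - f (z + h *\<^sub>R X + 0 *\<^sub>R Y)) -
        (f (z + 0 *\<^sub>R X + h *\<^sub>R Y) - f (z + 0 *\<^sub>R X + 0 *\<^sub>R Y))
      = (h - 0) *\<^sub>R d (z + s *\<^sub>R X + h *\<^sub>R Y) X - (h - 0) *\<^sub>R d (z + s *\<^sub>R X + 0 *\<^sub>R Y) X"
  proof -
    have "\<exists>s\<in>{0<..<h}. (\<lambda>s. f (z + s *\<^sub>R X + h *\<^sub>R Y) - f (z + s *\<^sub>R X + 0 *\<^sub>R Y)) h -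
        (\<lambda>s. f (z + s *\<^sub>R X + h *\<^sub>R Y) - f (z + s *\<^sub>R X + 0 *\<^sub>R Y)) 0 =
        (\<lambda>r. d (z + s *\<^sub>R X + h *\<^sub>R Y) (r *\<^sub>R X) - d (z + s *\<^sub>R X + 0 *\<^sub>R Y) (r *\<^sub>R X)) (h - 0)"
    proof (rule mvt_simple[OF assms(3)])
      fix s assume "0 \<le> s" "s \<le> h"
      then show "((\<lambda>s. f (z + s *\<^sub>R X + h *\<^sub>R Y) - f (z + s *\<^sub>R X + 0 *\<^sub>R Y)) has_derivative
          (\<lambda>r. d (z + s *\<^sub>R X + h *\<^sub>R Y) (r *\<^sub>R X) - d (z + s *\<^sub>R X + 0 *\<^sub>R Y) (r *\<^sub>R X))) (at s within {0..h})"
        using inS[of s h] inS[of s 0] assms(3)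
        by (intro has_derivative_diff has_derivative_compose[OF affX fd]) auto
    qed
    then obtain s where s: "s \<in> {0<..<h}" and e: "(f (z + h *\<^sub>R X + h *\<^sub>R Y) - f (z + h *\<^sub>R X + 0 *\<^sub>R Y)) -
        (f (z + 0 *\<^sub>R X + h *\<^sub>R Y) - f (z + 0 *\<^sub>R X + 0 *\<^sub>R Y))
      = d (z + s *\<^sub>R X + h *\<^sub>R Y) ((h - 0) *\<^sub>R X) - d (z + s *\<^sub>R X + 0 *\<^sub>R Y) ((h - 0) *\<^sub>R X)" by auto
    have "linear (d w)" if "w \<in> S" for w using fd[OF that] has_derivative_linear by blast
    then show ?thesis using e s inS[of s h] inS[of s 0] by (auto simp: linear_cmul intro!: bexI[of _ s])
  qed
  then obtain s where s: "0 < s" "s < h" and e1: "f (z + h *\<^sub>R X + h *\<^sub>R Y) - f (z + h *\<^sub>R X)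
        - f (z + h *\<^sub>R Y) + f z
      = h * (d (z + s *\<^sub>R X + h *\<^sub>R Y) X - d (z + s *\<^sub>R X + 0 *\<^sub>R Y) X)"
    by (auto simp: algebra_simps)
  \<comment> \<open>Second use, along \<open>Y\<close>, for the derivative in direction
    \<open>X\<close> with \<open>s\<close> fixed.\<close>
  have "\<exists>t\<in>{0<..<h}. (\<lambda>t. d (z + s *\<^sub>R X + t *\<^sub>R Y) X) h - (\<lambda>t. d (z + s *\<^sub>R X + t *\<^sub>R Y) X) 0
      = (\<lambda>r. dd (z + s *\<^sub>R X + t *\<^sub>R Y) (r *\<^sub>R Y)) (h - 0)"
  proof (rule mvt_simple[OF assms(3)])
    fix t assume "0 \<le> t" "t \<le> h"
    then show "((\<lambda>t. d (z + s *\<^sub>R X + t *\<^sub>R Y) X) has_derivative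
        (\<lambda>r. dd (z + s *\<^sub>R X + t *\<^sub>R Y) (r *\<^sub>R Y))) (at t within {0..h})"
      using inS[of s t] s
      by (intro has_derivative_compose[OF affY dfd]) auto
  qed
  then obtain t where t: "0 < t" "t < h" and e2: "d (z + s *\<^sub>R X + h *\<^sub>R Y) X - d (z + s *\<^sub>R X + 0 *\<^sub>R Y) X
      = dd (z + s *\<^sub>R X + t *\<^sub>R Y) (h *\<^sub>R Y)" by auto
  have "dd (z + s *\<^sub>R X + t *\<^sub>R Y) (h *\<^sub>R Y) = h * dd (z + s *\<^sub>R X + t *\<^sub>R Y) Y"
    using linear_cmul[OF has_derivative_linear[OF dfd]] inS[of s t] s t by simp
  then show ?thesis
    using e1 e2 inS(2)[of s t] s t unfolding dd_def d_def by (intro exI[of _ "z + s *\<^sub>R X + t *\<^sub>R Y"]) auto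
qed

text \<open>The second difference of a small parallelogram equals \<open>h * h\<close> times either
  mixed derivative, each at some nearby point. So the two mixed derivatives share a value near
  \<open>z\<close>, and by continuity they cannot differ at \<open>z\<close>.\<close>

lemma frechet_derivative_commute_real:
  fixes f :: "'a::real_normed_vector \<Rightarrow> real"
  assumes "open S" "smooth_on S f" "z \<in> S"
  shows "frechet_derivative (\<lambda>w. frechet_derivative f (at w) X) (at z) Y
    = frechet_derivative (\<lambda>w. frechet_derivative f (at w) Y) (at z) X" (is "?F z = ?G z")
proof (rule ccontr)
  assume ne: "?F z \<noteq> ?G z"
  \<comment> \<open>Half the distance: passing through the shared value then bounds that distance
    strictly by itself.\<close>
  define e where "e = dist (?F z) (?G z) / 2"
  have e: "e > 0" using ne by (simp add: e_def)
  have "continuous_on S ?F" "continuous_on S ?G"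
    using smooth_on_imp_continuous_on smooth_on_frechet_derivative assms(2) by blast+
  then have "isCont ?F z" "isCont ?G z" using assms by (auto simp: continuous_on_eq_continuous_at)
  then obtain d1 d2 where d: "d1 > 0" "\<And>u. dist u z < d1 \<Longrightarrow> dist (?F u) (?F z) < e"
      "d2 > 0" "\<And>u. dist u z < d2 \<Longrightarrow> dist (?G u) (?G z) < e"
    using e unfolding continuous_at_eps_delta by metis
  obtain d3 where d3: "d3 > 0" "cball z d3 \<subseteq> S" using assms open_contains_cball by metis
  define m where "m = Min {d1, d2, d3} / 2"
  have m: "m > 0" "m < d1" "m < d2" "m < d3" using d d3 by (auto simp: m_def)
  \<comment> \<open>The parallelogram must lie within radius \<open>m\<close> of \<open>z\<close>;
    the summand 1 keeps the denominator positive even for \<open>X\<close> and \<open>Y\<close> both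
    zero.\<close>
  define h where "h = m / (norm X + norm Y + 1)"
  have n: "norm X + norm Y + 1 > 0" by (smt (verit) norm_ge_zero)
  have h: "h > 0" using m n by (simp add: h_def)
  have "h * (norm X + norm Y) \<le> h * (norm X + norm Y + 1)" using h by simp
  also have "\<dots> = m" using n by (simp add: h_def)
  finally have hm: "h * (norm X + norm Y) \<le> m" .
  then have "cball z (h * (norm X + norm Y)) \<subseteq> S" "cball z (h * (norm Y + norm X)) \<subseteq> S"
    using d3 m by (auto simp: add.commute)
  from second_difference_mvt[OF assms(1,2) h this(1)] second_difference_mvt[OF assms(1,2) h this(2)]
  obtain u v where u: "dist z u \<le> h * (norm X + norm Y)"
      "f (z + h *\<^sub>R X + h *\<^sub>R Y) - f (z + h *\<^sub>R X) - f (z + h *\<^sub>R Y) + f z = h * h * ?F u"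
    and v: "dist z v \<le> h * (norm Y + norm X)"
      "f (z + h *\<^sub>R Y + h *\<^sub>R X) - f (z + h *\<^sub>R Y) - f (z + h *\<^sub>R X) + f z = h * h * ?G v" by blast
  have "h * h * ?F u = h * h * ?G v" using u(2) v(2) by (simp add: algebra_simps)
  then have "?F u = ?G v" using h by simp
  moreover have "dist (?F u) (?F z) < e" "dist (?G v) (?G z) < e"
    using d u(1) v(1) hm m by (auto simp: dist_commute add.commute)
  ultimately have "dist (?F z) (?G z) < 2 * e"
    by (smt (verit) dist_commute dist_triangle)
  then show False by (simp add: e_def)
qed

text \<open>The mean value argument concerns real values, so it is applied to each coordinate, that
  is, to the inner product with each basis vector.\<close>

lemma frechet_derivative_commute:
  fixes f :: "'a::real_normed_vector \<Rightarrow> 'b::euclidean_space"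
  assumes "open S" "smooth_on S f" "z \<in> S"
  shows "frechet_derivative (\<lambda>w. frechet_derivative f (at w) X) (at z) Y
    = frechet_derivative (\<lambda>w. frechet_derivative f (at w) Y) (at z) X"
proof (rule euclidean_eqI)
  fix b :: 'b assume "b \<in> Basis"
  have lin: "linear (\<lambda>v::'b. v \<bullet> b)" by (auto intro: linearI simp: inner_add_left)
  have sm: "smooth_on S (\<lambda>w. f w \<bullet> b)" by (rule smooth_on_linear[OF lin assms(1,2)])
  have d: "frechet_derivative g (at w) v \<bullet> b = frechet_derivative (\<lambda>w. g w \<bullet> b) (at w) v"
    if "smooth_on S g" "w \<in> S" for g :: "'a \<Rightarrow> 'b" and w v
    using frechet_derivative_at[OF has_derivative_inner_left[OF smooth_on_has_derivative[OF that]]]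
    by metis
  have dd: "frechet_derivative (\<lambda>w. frechet_derivative f (at w) X) (at z) Y \<bullet> b
      = frechet_derivative (\<lambda>w. frechet_derivative (\<lambda>w. f w \<bullet> b) (at w) X) (at z) Y" for X Y
  proof -
    have sX: "smooth_on S (\<lambda>w. frechet_derivative f (at w) X)"
      by (rule smooth_on_frechet_derivative[OF assms(2)])
    have "((\<lambda>w. frechet_derivative f (at w) X \<bullet> b) has_derivative
        (\<lambda>v. frechet_derivative (\<lambda>w. frechet_derivative f (at w) X) (at z) v \<bullet> b)) (at z)"
      by (rule has_derivative_inner_left[OF smooth_on_has_derivative[OF sX assms(3)]])
    then have "((\<lambda>w. frechet_derivative (\<lambda>w. f w \<bullet> b) (at w) X) has_derivative
        (\<lambda>v. frechet_derivative (\<lambda>w. frechet_derivative f (at w) X) (at z) v \<bullet> b)) (at z)"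
      by (rule has_derivative_transform_within_open[OF _ assms(1,3)]) (use d[OF assms(2)] in auto)
    then show ?thesis using frechet_derivative_at by metis
  qed
  show "frechet_derivative (\<lambda>w. frechet_derivative f (at w) X) (at z) Y \<bullet> b
    = frechet_derivative (\<lambda>w. frechet_derivative f (at w) Y) (at z) X \<bullet> b"
    unfolding dd by (rule frechet_derivative_commute_real[OF assms(1) sm assms(3)])
qed

section \<open>Linear algebra of matrices\<close>

lemma mscale_nth [simp]: "mscale a A $ i $ j = a * A $ i $ j"
  by (simp add: mscale_def)

lemmas matrix_mult_left_simps =
  bounded_bilinear.add_left[OF bounded_bilinear_matrix_matrix_mult]
  bounded_bilinear.diff_left[OF bounded_bilinear_matrix_matrix_mult]
  bounded_bilinear.minus_left[OF bounded_bilinear_matrix_matrix_mult]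
  bounded_bilinear.zero_left[OF bounded_bilinear_matrix_matrix_mult]

lemmas matrix_mult_right_simps =
  bounded_bilinear.add_right[OF bounded_bilinear_matrix_matrix_mult]
  bounded_bilinear.diff_right[OF bounded_bilinear_matrix_matrix_mult]
  bounded_bilinear.minus_right[OF bounded_bilinear_matrix_matrix_mult]
  bounded_bilinear.zero_right[OF bounded_bilinear_matrix_matrix_mult]

lemma scaleR_mscale: "r *\<^sub>R A = mscale (complex_of_real r) A"
  by (simp add: vec_eq_iff scaleR_conv_of_real[where ?'a=complex])

lemma mscale_mult_left: "mscale a A ** B = mscale a (A ** B)"
  by (simp add: vec_eq_iff matrix_matrix_mult_def sum_distrib_left mult.assoc)

lemma mscale_mult_right: "A ** mscale a B = mscale a (A ** B)"
  by (simp add: vec_eq_iff matrix_matrix_mult_def sum_distrib_left algebra_simps)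

lemmas matrix_ring_simps = matrix_mult_left_simps matrix_mult_right_simps
  mscale_mult_left mscale_mult_right matrix_mul_assoc

lemma mscale_mult_vec: "mscale a A *v x = a *s (A *v x)"
  by (simp add: vec_eq_iff matrix_vector_mult_def sum_distrib_left mult.assoc)

lemma linear_mscale: "linear (mscale a)"
  by (rule linearI) (simp_all add: vec_eq_iff algebra_simps)

lemma mscale_simps:
  "mscale a (A + B) = mscale a A + mscale a B" "mscale a (A - B) = mscale a A - mscale a B"
  "mscale a (- A) = - mscale a A" "mscale a 0 = 0" "mscale 0 A = 0" "mscale 1 A = A"
  "mscale a (mscale b A) = mscale (a * b) A"
  by (simp_all add: vec_eq_iff algebra_simps)

lemma lie_bracket_simps:
  "lie_bracket (A + B) C = lie_bracket A C + lie_bracket B C"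
  "lie_bracket (A - B) C = lie_bracket A C - lie_bracket B C"
  "lie_bracket (- A) C = - lie_bracket A C"
  "lie_bracket A (B + C) = lie_bracket A B + lie_bracket A C"
  "lie_bracket A (B - C) = lie_bracket A B - lie_bracket A C"
  "lie_bracket A (- C) = - lie_bracket A C"
  "lie_bracket (mscale a A) C = mscale a (lie_bracket A C)"
  "lie_bracket A (mscale a C) = mscale a (lie_bracket A C)"
  "lie_bracket A A = 0"
  by (simp_all add: lie_bracket_def matrix_ring_simps mscale_simps algebra_simps)

lemma lie_bracket_commute: "lie_bracket A B = - lie_bracket B A"
  by (simp add: lie_bracket_def)

text \<open>This is the adjoint action; \<open>Ad_form\<close> applies it at each point.\<close>

definition conjugate :: "complex^'n^'n \<Rightarrow> complex^'n^'n \<Rightarrow> complex^'n^'n" where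
  "conjugate g S = g ** S ** matrix_inv g"

lemma conjugate_simps:
  "conjugate g (A + B) = conjugate g A + conjugate g B"
  "conjugate g (A - B) = conjugate g A - conjugate g B"
  "conjugate g (- A) = - conjugate g A"
  "conjugate g (mscale a A) = mscale a (conjugate g A)"
  by (simp_all add: conjugate_def matrix_ring_simps)

lemma conjugate_mult:
  assumes "invertible g"
  shows "conjugate g (A ** B) = conjugate g A ** conjugate g B"
proof -
  have "conjugate g A ** conjugate g B = g ** A ** (matrix_inv g ** g) ** B ** matrix_inv g"
    by (simp only: conjugate_def matrix_mul_assoc)
  then show ?thesis by (simp add: matrix_inv_cancel[OF assms] conjugate_def matrix_mul_assoc)
qed

lemma conjugate_lie_bracket:
  "invertible g \<Longrightarrow> conjugate g (lie_bracket A B) = lie_bracket (conjugate g A) (conjugate g B)"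
  by (simp add: lie_bracket_def conjugate_simps conjugate_mult)

lemma conjugate_mult_vec:
  "invertible g \<Longrightarrow> conjugate g A *v (g *v x) = g *v (A *v x)"
  by (simp add: conjugate_def matrix_vector_mul_assoc flip: matrix_mul_assoc) 
    (simp add: matrix_inv_cancel)

lemma matrix_inv_mult_vec:
  assumes "invertible g"
  shows "g *v (matrix_inv g *v x) = x" "matrix_inv g *v (g *v x) = x"
  by (simp_all add: matrix_vector_mul_assoc matrix_inv_cancel assms)

lemma linear_conjugate: "linear (conjugate g)"
  by (rule linearI) (simp_all add: conjugate_simps scaleR_mscale)

lemma matrix_vector_mult_smult: "A *v (a *s x) = a *s (A *v x)"
  for A :: "complex^'n^'m"
  by (simp add: vec_eq_iff matrix_vector_mult_def sum_distrib_left algebra_simps)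

lemma matrix_vector_linear_unique:
  fixes B :: "complex^'n^'m"
  assumes "\<And>v. f v = B *v v"
  shows "matrix f = B"
  using assms matrix_of_matrix_vector_mul[of B] by (metis ext)

section \<open>The Minkowski form and orthogonal projections\<close>

lemma mink_commute: "mink v w = mink w v"
  by (simp add: mink_def mult.commute)

lemma mink_simps:
  fixes u v w :: "'k::finite cvec"
  shows "mink (u + v) w = mink u w + mink v w" "mink (u - v) w = mink u w - mink v w"
    "mink (a *s v) w = a * mink v w" "mink 0 w = 0"
    "mink w (u + v) = mink w u + mink w v" "mink w (u - v) = mink w u - mink w v"
    "mink w (a *s v) = a * mink w v" "mink w 0 = 0"
  by (simp_all add: mink_def algebra_simps sum.distrib sum_subtractf sum_distrib_left)

lemma mink_axis:
  fixes v :: "'k::finite cvec"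
  shows "mink v (axis (Some i) 1) = v $ Some i" "mink v (axis None 1) = - v $ None"
  by (simp_all add: mink_def axis_def if_distrib cong: if_cong)

text \<open>Pairing with the axis vectors recovers the coordinates, up to sign for the timelike
  one.\<close>

lemma mink_eq_0_imp_0:
  fixes v :: "'k::finite cvec"
  assumes "\<And>w. mink v w = 0"
  shows "v = 0"
proof -
  have "v $ i = 0" for i
    using assms[of "axis i 1"] by (cases i) (simp_all add: mink_axis)
  then show ?thesis by (simp add: vec_eq_iff)
qed

text \<open>\<open>proj\<close> is a definite description. A matrix with this property settles
  existence, and non-degeneracy of \<open>V\<close> settles uniqueness, so that projections can be
  computed with matrices.\<close>

definition orth_projector :: "'k::finite cvec set \<Rightarrow> 'k cmat \<Rightarrow> bool" where
  "orth_projector V P \<longleftrightarrow> vec.subspace V \<and> nondegenerate V \<and>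
     (\<forall>v. P *v v \<in> V \<and> v - P *v v \<in> orth V)"

lemma subspace_orth: "vec.subspace (orth S)"
  by (rule vec.subspaceI) (auto simp: orth_def mink_simps)

lemma orth_projectorD:
  assumes "orth_projector V P"
  shows "P *v v \<in> V" "v - P *v v \<in> orth V" "vec.subspace V" "nondegenerate V"
    "v \<in> V \<Longrightarrow> v \<in> orth V \<Longrightarrow> v = 0"
  using assms by (auto simp: orth_projector_def nondegenerate_def)

lemma orth_projector_in:
  assumes "orth_projector V P" "v \<in> V"
  shows "P *v v = v"
proof -
  have "v - P *v v \<in> V" using orth_projectorD[OF assms(1)] assms(2) vec.subspace_diff by blast
  then have "v - P *v v = 0" using orth_projectorD[OF assms(1)] by blast
  then show ?thesis by simp
qed

lemma orth_projector_orth: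
  assumes "orth_projector V P" "v \<in> orth V"
  shows "P *v v = 0"
proof -
  have "P *v v = v - (v - P *v v)" by simp
  then have "P *v v \<in> orth V"
    using orth_projectorD[OF assms(1)] assms(2) vec.subspace_diff[OF subspace_orth] by metis
  then show ?thesis using orth_projectorD[OF assms(1)] by blast
qed

lemma orth_projector_idem:
  assumes "orth_projector V P"
  shows "P ** P = P"
  using orth_projector_in[OF assms orth_projectorD(1)[OF assms]]
  by (simp add: matrix_eq flip: matrix_vector_mul_assoc)

lemma proj_orth_projector:
  assumes "orth_projector V P"
  shows "proj V v = P *v v"
  unfolding proj_def
proof (rule the_equality)
  show "P *v v \<in> V \<and> v - P *v v \<in> orth V" using orth_projectorD[OF assms] by blast
  show "u = P *v v" if u: "u \<in> V \<and> v - u \<in> orth V" for u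
    using orth_projector_in[OF assms, of u] orth_projector_orth[OF assms, of "v - u"] u
    by (simp add: matrix_vector_mult_diff_distrib)
qed

text \<open>The difference \<open>d\<close> of two candidates is orthogonal to \<open>orth V\<close>
  and to \<open>V\<close>. Every \<open>w\<close> splits as \<open>P *v w\<close> plus a vector of
  \<open>orth V\<close>, so \<open>d\<close> is orthogonal to everything.\<close>

lemma proj_orth_orth_projector:
  assumes "orth_projector V P"
  shows "proj (orth V) v = v - P *v v"
  unfolding proj_def
proof (rule the_equality)
  have PV: "P *v x \<in> orth (orth V)" for x
    using orth_projectorD(1)[OF assms, of x] unfolding orth_def
    by (auto simp: mink_commute[of "P *v x"])
  show "v - P *v v \<in> orth V \<and> v - (v - P *v v) \<in> orth (orth V)"
    using orth_projectorD[OF assms] PV by simp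
  fix u assume u: "u \<in> orth V \<and> v - u \<in> orth (orth V)"
  define d where "d = (v - P *v v) - u"
  have d1: "d \<in> orth V" unfolding d_def
    using u orth_projectorD(2)[OF assms] vec.subspace_diff[OF subspace_orth] by blast
  have "d = (v - u) - P *v v" by (simp add: d_def)
  then have d2: "d \<in> orth (orth V)"
    using u PV vec.subspace_diff[OF subspace_orth] by metis
  have "mink d w = 0" for w
  proof -
    have "mink d (P *v w) = 0" "mink d (w - P *v w) = 0"
      using d1 d2 orth_projectorD(1,2)[OF assms, of w] by (auto simp: orth_def)
    then show ?thesis by (simp add: mink_simps)
  qed
  then have "d = 0" by (rule mink_eq_0_imp_0)
  then show "u = v - P *v v" by (simp add: d_def)
qed

section \<open>Orthogonal projectors from frames\<close>

text \<open>The projector onto the span of a frame that need not be orthogonal: the last factor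
  pairs a vector with the frame, the inverse Gram matrix turns these numbers into coefficients, and
  the first factor recombines the frame. The formula shows smooth dependence on the frame.\<close>

definition gram_projector :: "('r::finite \<Rightarrow> 'k::finite cvec) \<Rightarrow> 'k cmat" where
  "gram_projector f = (\<chi> k j. f j $ k) ** matrix_inv (\<chi> i j. mink (f i) (f j)) **
     (\<chi> i k. mink (f i) (axis k 1))"

lemma mult_columns: "(\<chi> k j. f j $ k) *v x = (\<Sum>j\<in>UNIV. x $ j *s f j)"
  for f :: "'r::finite \<Rightarrow> complex^'n"
  by (simp add: vec_eq_iff matrix_vector_mult_def mult.commute)

lemma mink_sum_right:
  fixes v :: "'k::finite cvec"
  shows "mink v (\<Sum>i\<in>I. g i) = (\<Sum>i\<in>I. mink v (g i))"
  by (induction I rule: infinite_finite_induct) (simp_all add: mink_simps)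

lemma mink_row:
  fixes f :: "'r::finite \<Rightarrow> 'k::finite cvec"
  shows "(\<chi> i k. mink (f i) (axis k 1)) *v v = (\<chi> i. mink (f i) v)"
proof -
  have "mink (f i) v = (\<Sum>k\<in>UNIV. mink (f i) (axis k 1) * v $ k)" for i
    using mink_sum_right[of "f i" "\<lambda>k. v $ k *s axis k 1" UNIV]
    by (simp add: basis_expansion mink_simps mult.commute)
  then show ?thesis by (simp add: vec_eq_iff matrix_vector_mult_def)
qed

text \<open>The dimension forces \<open>f\<close> to be injective with independent range. A kernel
  vector gives a combination \<open>y\<close> of the frame orthogonal to the whole span, so
  \<open>y\<close> vanishes by non-degeneracy and its coefficients vanish by independence.\<close>

lemma gram_invertible:
  fixes f :: "'r::finite \<Rightarrow> 'k::finite cvec"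
  assumes "vec.dim (vec.span (range f)) = CARD('r)" "nondegenerate (vec.span (range f))"
  shows "invertible (\<chi> i j. mink (f i) (f j))"
proof -
  have card: "card (range f) = CARD('r)"
  proof (rule antisym)
    show "card (range f) \<le> CARD('r)" by (simp add: card_image_le)
    show "CARD('r) \<le> card (range f)"
      using assms(1) vec.dim_le_card[of "range f" "range f"] by (simp add: vec.span_superset)
  qed
  then have inj: "inj f" by (simp add: eq_card_imp_inj_on)
  have ind: "vec.independent (range f)"
    by (rule vec.card_le_dim_spanning[of _ "vec.span (range f)"])
      (use assms(1) card in \<open>auto simp: vec.span_superset\<close>)
  have "x = 0" if "(\<chi> i j. mink (f i) (f j)) *v x = 0" for x
  proof -
    define y where "y = (\<Sum>j\<in>UNIV. x $ j *s f j)"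
    have y: "y \<in> vec.span (range f)" unfolding y_def
      by (intro vec.span_sum vec.span_scale vec.span_base) auto
    have "mink (f i) y = ((\<chi> i j. mink (f i) (f j)) *v x) $ i" for i
      by (simp add: y_def mink_sum_right mink_simps matrix_vector_mult_def mult.commute)
    then have "mink y (f i) = 0" for i using that by (simp add: mink_commute)
    then have "range f \<subseteq> {w. mink y w = 0}" by auto
    moreover have "vec.subspace {w. mink y w = 0}"
      by (rule vec.subspaceI) (auto simp: mink_simps)
    ultimately have "vec.span (range f) \<subseteq> {w. mink y w = 0}" by (rule vec.span_minimal)
    then have "y \<in> orth (vec.span (range f))" by (auto simp: orth_def)
    then have "y = 0" using y assms(2) by (auto simp: nondegenerate_def)
    \<comment> \<open>Independence is a property of the set \<open>range f\<close>, so the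
      coefficients are transported to it by \<open>inv f\<close>.\<close>
    then have "(\<Sum>v\<in>range f. x $ (inv f v) *s v) = 0"
      by (simp add: sum.reindex[OF inj] inj y_def)
    then have "x $ (inv f v) = 0" if "v \<in> range f" for v
      using vec.independentD[OF ind, of "range f" "\<lambda>v. x $ (inv f v)" v] that by simp
    then have "x $ j = 0" for j using inj by (metis inv_f_f rangeI)
    then show ?thesis by (simp add: vec_eq_iff)
  qed
  then show ?thesis
    using matrix_left_invertible_ker invertible_left_inverse by blast
qed

text \<open>The coefficients \<open>?x\<close> solve the normal equations, which say exactly that
  the remainder is orthogonal to every frame vector.\<close>

lemma orth_projector_gram:
  fixes f :: "'r::finite \<Rightarrow> 'k::finite cvec"
  assumes "vec.dim (vec.span (range f)) = CARD('r)" "nondegenerate (vec.span (range f))"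
  shows "orth_projector (vec.span (range f)) (gram_projector f)"
  unfolding orth_projector_def
proof (intro conjI allI)
  fix v :: "'k cvec"
  let ?G = "\<chi> i j. mink (f i) (f j)"
  let ?x = "matrix_inv ?G *v (\<chi> i. mink (f i) v)"
  have P: "gram_projector f *v v = (\<Sum>j\<in>UNIV. ?x $ j *s f j)"
    by (simp add: gram_projector_def mink_row mult_columns flip: matrix_vector_mul_assoc)
  show "gram_projector f *v v \<in> vec.span (range f)" unfolding P
    by (intro vec.span_sum vec.span_scale vec.span_base) auto
  have Gx: "?G *v ?x = (\<chi> i. mink (f i) v)"
    by (rule matrix_inv_mult_vec[OF gram_invertible[OF assms]])
  have "mink (f i) (gram_projector f *v v) = (?G *v ?x) $ i" for i
    unfolding P by (simp add: mink_sum_right mink_simps matrix_vector_mult_def[of ?G] mult.commute)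
  then have "mink (v - gram_projector f *v v) (f i) = 0" for i
    unfolding Gx by (simp add: mink_simps mink_commute[of _ "f i"])
  then have "range f \<subseteq> {w. mink (v - gram_projector f *v v) w = 0}" by auto
  moreover have "vec.subspace {w. mink (v - gram_projector f *v v) w = 0}"
    by (rule vec.subspaceI) (auto simp: mink_simps)
  ultimately have "vec.span (range f) \<subseteq> {w. mink (v - gram_projector f *v v) w = 0}"
    by (rule vec.span_minimal)
  then show "v - gram_projector f *v v \<in> orth (vec.span (range f))" by (auto simp: orth_def)
qed (use assms in auto)

lemma smooth_on_mink:
  fixes f g :: "'a::real_normed_vector \<Rightarrow> 'k::finite cvec"
  assumes "open S" "smooth_on S f" "smooth_on S g"
  shows "smooth_on S (\<lambda>x. mink (f x) (g x))"
  unfolding mink_def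
  by (intro smooth_on_diff[OF assms(1)] smooth_on_sum[OF assms(1)]
      smooth_on_bilinear[OF bounded_bilinear_mult assms(1)] smooth_on_nth[OF assms(1)] assms(2,3))

lemma smooth_on_gram_projector:
  fixes f :: "'r::finite \<Rightarrow> 'a::real_normed_vector \<Rightarrow> 'k::finite cvec"
  assumes S: "open S" and f: "\<And>j. smooth_on S (f j)"
    and inv: "\<And>x. x \<in> S \<Longrightarrow> invertible (\<chi> i j. mink (f i x) (f j x))"
  shows "smooth_on S (\<lambda>x. gram_projector (\<lambda>j. f j x))"
  unfolding gram_projector_def
proof (intro smooth_on_matrix_mult[OF S] smooth_on_matrix_inv[OF S _ inv])
  show "smooth_on S (\<lambda>x. \<chi> k j. f j x $ k)"
    by (rule smooth_on_matrix[OF S]) (simp add: smooth_on_nth[OF S f])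
  show "smooth_on S (\<lambda>x. \<chi> i j. mink (f i x) (f j x))"
    by (rule smooth_on_matrix[OF S]) (simp add: smooth_on_mink[OF S f f])
  show "smooth_on S (\<lambda>x. \<chi> i k. mink (f i x) (axis k 1))"
    by (rule smooth_on_matrix[OF S]) (simp add: smooth_on_mink[OF S f smooth_on_const])
qed auto

section \<open>Isometries acting on subspaces and on their projectors\<close>

definition isometry :: "'k::finite cmat \<Rightarrow> bool" where
  "isometry g \<longleftrightarrow> invertible g \<and> (\<forall>v w. mink (g *v v) (g *v w) = mink v w)"

lemma isometryD:
  assumes "isometry g"
  shows "invertible g" "mink (g *v v) (g *v w) = mink v w"
    "mink (matrix_inv g *v v) w = mink v (g *v w)"
proof -
  show 1: "invertible g" and 2: "mink (g *v v) (g *v w) = mink v w" for v w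
    using assms by (auto simp: isometry_def)
  show "mink (matrix_inv g *v v) w = mink v (g *v w)"
    using 2[of "matrix_inv g *v v" w] by (simp add: matrix_inv_mult_vec[OF 1])
qed

lemma isometry_image_iff:
  assumes "isometry g"
  shows "v \<in> (*v) g ` S \<longleftrightarrow> matrix_inv g *v v \<in> S"
  using matrix_inv_mult_vec[OF isometryD(1)[OF assms]] by (metis image_iff)

lemma isometry_orth_image:
  assumes "isometry g"
  shows "orth ((*v) g ` S) = (*v) g ` orth S"
  by (auto simp: isometry_image_iff[OF assms] orth_def isometryD(2,3)[OF assms])

lemma isometry_nondegenerate_image:
  assumes "isometry g" "nondegenerate S"
  shows "nondegenerate ((*v) g ` S)"
proof -
  have "inj ((*v) g)" using matrix_inv_mult_vec(2)[OF isometryD(1)[OF assms(1)]] by (metis injI)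
  then have "(*v) g ` S \<inter> (*v) g ` orth S = (*v) g ` (S \<inter> orth S)"
    by (simp add: image_Int)
  then show ?thesis using assms(2) by (simp add: nondegenerate_def isometry_orth_image[OF assms(1)])
qed

text \<open>An isometry commutes with \<open>orth\<close>, so it carries the splitting of a vector
  along \<open>V\<close> to the splitting along the image of \<open>V\<close>.\<close>

lemma isometry_orth_projector:
  assumes "isometry g" "orth_projector V P"
  shows "orth_projector ((*v) g ` V) (conjugate g P)"
proof -
  have "conjugate g P *v v \<in> (*v) g ` V \<and> v - conjugate g P *v v \<in> (*v) g ` orth V" for v
  proof -
    have v: "v = g *v (matrix_inv g *v v)"
      using matrix_inv_mult_vec(1)[OF isometryD(1)[OF assms(1)]] by simp
    have c: "conjugate g P *v v = g *v (P *v (matrix_inv g *v v))"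
      by (subst v) (rule conjugate_mult_vec[OF isometryD(1)[OF assms(1)]])
    have "v - conjugate g P *v v = g *v (matrix_inv g *v v - P *v (matrix_inv g *v v))"
      using v c by (simp add: matrix_vector_mult_diff_distrib)
    then show ?thesis using c orth_projectorD(1,2)[OF assms(2)] by auto
  qed
  then show ?thesis
    unfolding orth_projector_def isometry_orth_image[OF assms(1)]
    using vec.subspace_image isometry_nondegenerate_image[OF assms(1)]
      orth_projectorD(3,4)[OF assms(2)] by blast
qed

section \<open>Bivectors\<close>

lemma wedge_mult_vec: "wedge v w *v x = mink x v *s w - mink x w *s v"
proof -
  have "Vector_Spaces.linear (*s) (*s) (\<lambda>x. mink x v *s w - mink x w *s v)"
    by unfold_locales (auto simp: mink_simps vec_eq_iff algebra_simps)
  then show ?thesis unfolding wedge_def by (rule matrix_works)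
qed

lemma subspace_wedge2: "subspace (wedge2 S)"
  by (simp add: wedge2_def)

text \<open>\<open>wedge2\<close> is a real span, so only real scaling appears among the cases;
  complex scaling is recovered in \<open>mscale_wedge2\<close>.\<close>

lemma wedge2_induct [consumes 1, case_names wedge add scale]:
  assumes "S \<in> wedge2 E"
    and "\<And>v w. v \<in> E \<Longrightarrow> w \<in> E \<Longrightarrow> Q (wedge v w)"
    and "\<And>S T. Q S \<Longrightarrow> Q T \<Longrightarrow> Q (S + T)"
    and "\<And>r S. Q S \<Longrightarrow> Q (r *\<^sub>R S)"
    and "Q 0"
  shows "Q S"
proof -
  have "subspace {S. Q S}" using assms(3-5) by (auto simp: subspace_def)
  moreover have "{wedge v w |v w. v \<in> E \<and> w \<in> E} \<subseteq> {S. Q S}" using assms(2) by auto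
  ultimately have "wedge2 E \<subseteq> {S. Q S}" unfolding wedge2_def by (rule span_minimal[rotated])
  then show ?thesis using assms(1) by auto
qed

lemma scaleR_matrix_vector: "(r *\<^sub>R A) *v x = complex_of_real r *s (A *v x)" for A :: "complex^'n^'m"
  by (simp add: vec_eq_iff matrix_vector_mult_def scaleR_conv_of_real[where ?'a=complex] sum_distrib_left mult.assoc)

lemma wedge2_mult_vec:
  assumes "S \<in> wedge2 E" "vec.subspace E"
  shows "S *v x \<in> E"
  using assms(1)
proof (induction rule: wedge2_induct)
  case (wedge v w)
  then show ?case using assms(2) by (simp add: wedge_mult_vec vec.subspace_diff vec.subspace_scale)
qed (use assms(2) in \<open>auto simp: matrix_vector_mult_add_rdistrib scaleR_matrix_vector
      vec.subspace_add vec.subspace_scale vec.subspace_0\<close>)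

lemma wedge2_mult_vec_orth:
  assumes "S \<in> wedge2 E" "x \<in> orth E"
  shows "S *v x = 0"
  using assms(1)
proof (induction rule: wedge2_induct)
  case (wedge v w)
  then show ?case using assms(2) by (simp add: wedge_mult_vec orth_def)
qed (auto simp: matrix_vector_mult_add_rdistrib scaleR_matrix_vector)

lemma mscale_wedge: "mscale a (wedge v w) = wedge (a *s v) w"
  by (simp add: matrix_eq mscale_mult_vec wedge_mult_vec mink_simps vec_eq_iff algebra_simps)

text \<open>A complex factor can be absorbed into the first vector of each generator.\<close>

lemma mscale_wedge2:
  assumes "S \<in> wedge2 E" "vec.subspace E"
  shows "mscale a S \<in> wedge2 E"
  using assms(1)
proof (induction rule: wedge2_induct)
  case (wedge v w)
  then show ?case unfolding mscale_wedge wedge2_def using assms(2) vec.subspace_scale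
    by (intro span_base) blast
qed (auto simp: mscale_simps linear_add[OF linear_mscale] linear_cmul[OF linear_mscale]
      subspace_add[OF subspace_wedge2] subspace_scale[OF subspace_wedge2] subspace_0[OF subspace_wedge2])

lemma conjugate_wedge:
  assumes "isometry g"
  shows "conjugate g (wedge v w) = wedge (g *v v) (g *v w)"
  by (simp add: matrix_eq conjugate_def wedge_mult_vec isometryD(3)[OF assms]
      matrix_vector_mult_diff_distrib matrix_vector_mult_smult flip: matrix_vector_mul_assoc)

lemma conjugate_wedge2:
  assumes "S \<in> wedge2 E" "isometry g"
  shows "conjugate g S \<in> wedge2 ((*v) g ` E)"
  using assms(1)
proof (induction rule: wedge2_induct)
  case (wedge v w)
  then show ?case unfolding conjugate_wedge[OF assms(2)] wedge2_def
    by (intro span_base) blast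
qed (auto simp: linear_0[OF linear_conjugate] linear_add[OF linear_conjugate] linear_cmul[OF linear_conjugate]
      subspace_add[OF subspace_wedge2] subspace_scale[OF subspace_wedge2] subspace_0[OF subspace_wedge2])

text \<open>\<open>S\<close> maps into \<open>V\<close> and kills \<open>orth V\<close>, while
  \<open>T\<close> maps into \<open>orth V\<close> and kills \<open>V\<close>, since
  \<open>V\<close> lies in \<open>orth (orth V)\<close>. Both therefore preserve the splitting that
  defines \<open>P\<close>.\<close>

lemma wedge2_commute_projector:
  assumes "orth_projector V P" "S \<in> wedge2 V" "T \<in> wedge2 (orth V)"
  shows "lie_bracket (S + T) P = 0"
proof -
  have "(S + T) *v (P *v x) = P *v ((S + T) *v x)" for x
  proof -
    have x: "x = P *v x + (x - P *v x)" by simp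
    have "P *v x \<in> orth (orth V)"
      using orth_projectorD(1)[OF assms(1), of x] by (auto simp: orth_def mink_commute[of "P *v x"])
    then have "T *v (P *v x) = 0" by (rule wedge2_mult_vec_orth[OF assms(3)])
    moreover have "S *v (x - P *v x) = 0"
      by (rule wedge2_mult_vec_orth[OF assms(2) orth_projectorD(2)[OF assms(1)]])
    then have "S *v x = S *v (P *v x)" by (simp add: matrix_vector_mult_diff_distrib)
    moreover have "P *v (S *v x) = S *v x"
      by (rule orth_projector_in[OF assms(1) wedge2_mult_vec[OF assms(2) orth_projectorD(3)[OF assms(1)]]])
    moreover have "P *v (T *v x) = 0"
      by (rule orth_projector_orth[OF assms(1) wedge2_mult_vec[OF assms(3) subspace_orth]])
    ultimately show ?thesis by (simp add: matrix_vector_mult_add_rdistrib matrix_vector_right_distrib)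
  qed
  then have "(S + T) ** P = P ** (S + T)" by (simp add: matrix_eq flip: matrix_vector_mul_assoc)
  then show ?thesis by (simp add: lie_bracket_def)
qed

section \<open>Calculus in a chart\<close>

definition chart_smooth :: "'m chart \<Rightarrow> ('m \<Rightarrow> 'b::real_normed_vector) \<Rightarrow> bool" where
  "chart_smooth c f \<longleftrightarrow> smooth_on (snd c ` fst c) (\<lambda>z. f (chart_inv c z))"

definition chart_deriv :: "'m chart \<Rightarrow> ('m \<Rightarrow> 'b::real_normed_vector) \<Rightarrow> 'm \<Rightarrow> complex \<Rightarrow> 'b" where
  "chart_deriv c f p X = frechet_derivative (\<lambda>z. f (chart_inv c z)) (at (snd c p)) X"

lemma dtriv_chart_deriv: "dtriv \<sigma> c p X = chart_deriv c \<sigma> p X"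
  by (simp add: dtriv_def chart_deriv_def o_def)

locale chart =
  fixes c :: "'m::topological_space chart"
  assumes open_range: "open (snd c ` fst c)"
    and chart_inv: "p \<in> fst c \<Longrightarrow> chart_inv c (snd c p) = p"
    and continuous_chart_inv: "continuous_on (snd c ` fst c) (chart_inv c)"
begin

lemma open_image:
  assumes "open W"
  shows "open (snd c ` (fst c \<inter> W))"
proof -
  have "snd c ` (fst c \<inter> W) = snd c ` fst c \<inter> chart_inv c -` W"
    using chart_inv by force
  then show ?thesis
    using continuous_open_preimage[OF continuous_chart_inv open_range assms] by simp
qed

lemma chart_smooth_cong:
  "chart_smooth c f \<Longrightarrow> (\<And>x. x \<in> fst c \<Longrightarrow> f x = g x) \<Longrightarrow> chart_smooth c g"
  unfolding chart_smooth_def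
  by (rule smooth_on_cong[OF open_range]) (use chart_inv in auto)

lemma chart_smooth_has_derivative:
  "chart_smooth c f \<Longrightarrow> p \<in> fst c \<Longrightarrow>
    ((\<lambda>z. f (chart_inv c z)) has_derivative chart_deriv c f p) (at (snd c p))"
  unfolding chart_smooth_def chart_deriv_def by (rule smooth_on_has_derivative) auto

lemma chart_deriv_eqI:
  "((\<lambda>z. f (chart_inv c z)) has_derivative f') (at (snd c p)) \<Longrightarrow> chart_deriv c f p X = f' X"
  unfolding chart_deriv_def using frechet_derivative_at by metis

lemma chart_deriv_cong:
  assumes "chart_smooth c f" "\<And>x. x \<in> fst c \<Longrightarrow> f x = g x" "p \<in> fst c"
  shows "chart_deriv c g p X = chart_deriv c f p X"
  by (rule chart_deriv_eqI, rule has_derivative_transform_within_open[OF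
        chart_smooth_has_derivative[OF assms(1,3)] open_range])
    (use assms chart_inv in auto)

lemma chart_smooth_const: "chart_smooth c (\<lambda>_. a)"
  by (simp add: chart_smooth_def smooth_on_const)

lemma chart_smooth_add: "chart_smooth c f \<Longrightarrow> chart_smooth c g \<Longrightarrow> chart_smooth c (\<lambda>x. f x + g x)"
  unfolding chart_smooth_def by (rule smooth_on_add[OF open_range])

lemma chart_smooth_diff: "chart_smooth c f \<Longrightarrow> chart_smooth c g \<Longrightarrow> chart_smooth c (\<lambda>x. f x - g x)"
  unfolding chart_smooth_def by (rule smooth_on_diff[OF open_range])

lemma chart_smooth_linear:
  fixes h :: "'b::euclidean_space \<Rightarrow> 'c::euclidean_space"
  shows "linear h \<Longrightarrow> chart_smooth c f \<Longrightarrow> chart_smooth c (\<lambda>x. h (f x))"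
  unfolding chart_smooth_def by (rule smooth_on_linear[OF _ open_range])

lemma chart_smooth_mult:
  "chart_smooth c f \<Longrightarrow> chart_smooth c g \<Longrightarrow> chart_smooth c (\<lambda>x. f x ** g x)"
  for f :: "'m \<Rightarrow> complex^'k^'l" and g :: "'m \<Rightarrow> complex^'n^'k"
  unfolding chart_smooth_def by (rule smooth_on_matrix_mult[OF open_range])

lemma chart_smooth_mult_vec:
  "chart_smooth c f \<Longrightarrow> chart_smooth c g \<Longrightarrow> chart_smooth c (\<lambda>x. f x *v g x)"
  for f :: "'m \<Rightarrow> complex^'k^'l" and g :: "'m \<Rightarrow> complex^'k"
  unfolding chart_smooth_def by (rule smooth_on_matrix_vector_mult[OF open_range])

lemma chart_smooth_matrix_inv:
  "chart_smooth c f \<Longrightarrow> (\<And>x. x \<in> fst c \<Longrightarrow> invertible (f x)) \<Longrightarrow> chart_smooth c (\<lambda>x. matrix_inv (f x))"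
  for f :: "'m \<Rightarrow> complex^'k^'k"
  unfolding chart_smooth_def by (rule smooth_on_matrix_inv[OF open_range]) (auto simp: chart_inv)

lemma chart_smooth_conjugate:
  "chart_smooth c g \<Longrightarrow> chart_smooth c f \<Longrightarrow> (\<And>x. x \<in> fst c \<Longrightarrow> invertible (g x))
    \<Longrightarrow> chart_smooth c (\<lambda>x. conjugate (g x) (f x))"
  unfolding conjugate_def by (intro chart_smooth_mult chart_smooth_matrix_inv)

lemma chart_smooth_chart_deriv:
  assumes "chart_smooth c f"
  shows "chart_smooth c (\<lambda>x. chart_deriv c f x X)"
  unfolding chart_smooth_def chart_deriv_def
  by (rule smooth_on_cong[OF open_range _ smooth_on_frechet_derivative[OF assms[unfolded chart_smooth_def]]])
    (use chart_inv in auto)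

text \<open>On the open chart image, \<open>chart_deriv\<close> is the ordinary derivative of the
  local representative, so this is the symmetry of second derivatives.\<close>

lemma chart_deriv_commute:
  fixes f :: "'m \<Rightarrow> 'b::euclidean_space"
  assumes "chart_smooth c f" "p \<in> fst c"
  shows "chart_deriv c (\<lambda>x. chart_deriv c f x X) p Y = chart_deriv c (\<lambda>x. chart_deriv c f x Y) p X"
proof -
  let ?f = "\<lambda>z. f (chart_inv c z)"
  have "chart_deriv c (\<lambda>x. chart_deriv c f x X) p Y
      = frechet_derivative (\<lambda>w. frechet_derivative ?f (at w) X) (at (snd c p)) Y" for X Y
  proof (rule chart_deriv_eqI, rule has_derivative_transform_within_open[OF _ open_range])
    show "((\<lambda>w. frechet_derivative ?f (at w) X) has_derivative
        frechet_derivative (\<lambda>w. frechet_derivative ?f (at w) X) (at (snd c p))) (at (snd c p))"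
      by (rule smooth_on_has_derivative[OF smooth_on_frechet_derivative[OF assms(1)[unfolded chart_smooth_def]]])
        (use assms in auto)
  qed (use assms chart_inv in \<open>auto simp: chart_deriv_def\<close>)
  then show ?thesis
    using frechet_derivative_commute[OF open_range assms(1)[unfolded chart_smooth_def], of "snd c p"] assms(2)
    by simp
qed

lemma chart_deriv_const [simp]: "chart_deriv c (\<lambda>_. a) p X = 0"
  by (rule chart_deriv_eqI) simp

lemma chart_deriv_add:
  "chart_smooth c f \<Longrightarrow> chart_smooth c g \<Longrightarrow> p \<in> fst c \<Longrightarrow>
    chart_deriv c (\<lambda>x. f x + g x) p X = chart_deriv c f p X + chart_deriv c g p X"
  by (rule chart_deriv_eqI) (intro has_derivative_add chart_smooth_has_derivative)

lemma chart_deriv_diff: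
  "chart_smooth c f \<Longrightarrow> chart_smooth c g \<Longrightarrow> p \<in> fst c \<Longrightarrow>
    chart_deriv c (\<lambda>x. f x - g x) p X = chart_deriv c f p X - chart_deriv c g p X"
  by (rule chart_deriv_eqI) (intro has_derivative_diff chart_smooth_has_derivative)

lemma chart_deriv_linear:
  fixes h :: "'b::euclidean_space \<Rightarrow> 'c::euclidean_space"
  shows "linear h \<Longrightarrow> chart_smooth c f \<Longrightarrow> p \<in> fst c \<Longrightarrow>
    chart_deriv c (\<lambda>x. h (f x)) p X = h (chart_deriv c f p X)"
  by (rule chart_deriv_eqI, rule bounded_linear.has_derivative[OF _ chart_smooth_has_derivative])
    (simp_all add: linear_conv_bounded_linear)

lemma chart_deriv_mult:
  fixes f :: "'m \<Rightarrow> complex^'k^'l" and g :: "'m \<Rightarrow> complex^'n^'k"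
  assumes "chart_smooth c f" "chart_smooth c g" "p \<in> fst c"
  shows "chart_deriv c (\<lambda>x. f x ** g x) p X = f p ** chart_deriv c g p X + chart_deriv c f p X ** g p"
  by (rule chart_deriv_eqI)
    (use has_derivative_matrix_mult[OF chart_smooth_has_derivative[OF assms(1,3)]
        chart_smooth_has_derivative[OF assms(2,3)]] chart_inv[OF assms(3)] in simp)

lemma chart_deriv_mult_vec:
  fixes f :: "'m \<Rightarrow> complex^'k^'l" and g :: "'m \<Rightarrow> complex^'k"
  assumes "chart_smooth c f" "chart_smooth c g" "p \<in> fst c"
  shows "chart_deriv c (\<lambda>x. f x *v g x) p X = f p *v chart_deriv c g p X + chart_deriv c f p X *v g p"
  by (rule chart_deriv_eqI)
    (use has_derivative_matrix_vector_mult[OF chart_smooth_has_derivative[OF assms(1,3)]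
        chart_smooth_has_derivative[OF assms(2,3)]] chart_inv[OF assms(3)] in simp)

lemma chart_deriv_is_linear:
  "chart_smooth c f \<Longrightarrow> p \<in> fst c \<Longrightarrow> linear (chart_deriv c f p)"
  using chart_smooth_has_derivative has_derivative_linear by blast

text \<open>Differentiate \<open>matrix_inv (f x) ** f x = mat 1\<close> and multiply by the inverse
  on the right.\<close>

lemma chart_deriv_matrix_inv:
  fixes f :: "'m \<Rightarrow> complex^'k^'k"
  assumes f: "chart_smooth c f" and inv: "\<And>x. x \<in> fst c \<Longrightarrow> invertible (f x)" and p: "p \<in> fst c"
    and B: "chart_deriv c f p X = f p ** B"
  shows "chart_deriv c (\<lambda>x. matrix_inv (f x)) p X = - (B ** matrix_inv (f p))"
proof -
  have sm: "chart_smooth c (\<lambda>x. matrix_inv (f x))" by (rule chart_smooth_matrix_inv[OF f inv])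
  have "chart_deriv c (\<lambda>x. matrix_inv (f x) ** f x) p X = 0"
    using chart_deriv_cong[OF chart_smooth_const[of "mat 1"], of "\<lambda>x. matrix_inv (f x) ** f x" p X]
    by (simp add: matrix_inv_cancel inv p)
  then have "matrix_inv (f p) ** (f p ** B) + chart_deriv c (\<lambda>x. matrix_inv (f x)) p X ** f p = 0"
    by (simp add: chart_deriv_mult[OF sm f p] B)
  then have "chart_deriv c (\<lambda>x. matrix_inv (f x)) p X ** f p = - B"
    by (simp add: matrix_mul_assoc matrix_inv_cancel inv p eq_neg_iff_add_eq_0 add.commute)
  then have "chart_deriv c (\<lambda>x. matrix_inv (f x)) p X ** (f p ** matrix_inv (f p)) = - B ** matrix_inv (f p)"
    by (simp add: matrix_mul_assoc)
  then show ?thesis by (simp add: matrix_inv_cancel inv p matrix_mult_left_simps)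
qed

text \<open>Here \<open>B\<close> is the logarithmic derivative g^-1 dg. Differentiating
  \<open>g\<close> and its inverse contributes the two halves of the bracket with \<open>B\<close>;
  the gauge formulas below rest on this.\<close>

lemma chart_deriv_conjugate:
  fixes g f :: "'m \<Rightarrow> complex^'k^'k"
  assumes g: "chart_smooth c g" and inv: "\<And>x. x \<in> fst c \<Longrightarrow> invertible (g x)" and f: "chart_smooth c f"
    and p: "p \<in> fst c" and B: "chart_deriv c g p X = g p ** B"
  shows "chart_deriv c (\<lambda>x. conjugate (g x) (f x)) p X
    = conjugate (g p) (chart_deriv c f p X + lie_bracket B (f p))"
  unfolding conjugate_def
  by (simp add: chart_deriv_mult chart_smooth_mult chart_smooth_matrix_inv
      chart_deriv_matrix_inv[OF g inv p B] B g f inv p lie_bracket_def matrix_ring_simps)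

end

section \<open>The connection of a smooth field of projectors\<close>

locale projector_chart = chart c
  for c :: "'m::topological_space chart" +
  fixes V :: "'m \<Rightarrow> 'k::finite cvec set" and P :: "'m \<Rightarrow> 'k cmat"
  assumes P: "x \<in> fst c \<Longrightarrow> orth_projector (V x) (P x)"
    and P_smooth: "chart_smooth c P"
begin

lemma P_idem: "p \<in> fst c \<Longrightarrow> P p ** P p = P p"
  using orth_projector_idem[OF P] .

lemma deriv_P:
  assumes "p \<in> fst c"
  shows "P p ** chart_deriv c P p X + chart_deriv c P p X ** P p = chart_deriv c P p X"
  using chart_deriv_cong[OF P_smooth, of "\<lambda>x. P x ** P x" p X] P_idem assms
  by (simp add: chart_deriv_mult[OF P_smooth P_smooth assms])

text \<open>Multiplying the derivative of \<open>P ** P = P\<close> by \<open>P\<close> from the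
  left leaves this. Hence dP maps \<open>V\<close> into \<open>orth V\<close>, and by
  \<open>deriv_P\<close> it maps \<open>orth V\<close> into \<open>V\<close>.\<close>

lemma P_deriv_P:
  assumes "p \<in> fst c"
  shows "P p ** chart_deriv c P p X ** P p = 0"
proof -
  have "P p ** (P p ** chart_deriv c P p X + chart_deriv c P p X ** P p) = P p ** chart_deriv c P p X"
    using deriv_P[OF assms] by simp
  then show ?thesis by (simp add: matrix_mult_right_simps matrix_mul_assoc P_idem[OF assms])
qed

text \<open>The product rule is applied to the two components of \<sigma>; after projecting, the
  terms other than d\<sigma> combine, by \<open>deriv_P\<close>, into the bracket of dP with
  \<open>P\<close>.\<close>

lemma DV_eq:
  assumes p: "p \<in> fst c" and s: "chart_smooth c \<sigma>"
  shows "DV V \<sigma> c p X = chart_deriv c \<sigma> p X - lie_bracket (chart_deriv c P p X) (P p) *v \<sigma> p"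
proof -
  let ?D = "chart_deriv c P p X" and ?s = "chart_deriv c \<sigma> p X"
  have Ps: "chart_smooth c (\<lambda>x. P x *v \<sigma> x)" by (rule chart_smooth_mult_vec[OF P_smooth s])
  have 1: "dtriv (\<lambda>x. proj (V x) (\<sigma> x)) c p X = P p *v ?s + ?D *v \<sigma> p"
    using chart_deriv_cong[OF Ps, of "\<lambda>x. proj (V x) (\<sigma> x)" p X] proj_orth_projector[OF P] p
    by (simp add: dtriv_chart_deriv chart_deriv_mult_vec[OF P_smooth s p])
  have 2: "dtriv (\<lambda>x. proj (orth (V x)) (\<sigma> x)) c p X = ?s - (P p *v ?s + ?D *v \<sigma> p)"
    using chart_deriv_cong[OF chart_smooth_diff[OF s Ps], of "\<lambda>x. proj (orth (V x)) (\<sigma> x)" p X]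
      proj_orth_orth_projector[OF P] p
    by (simp add: dtriv_chart_deriv chart_deriv_mult_vec[OF P_smooth s p] chart_deriv_diff[OF s Ps p])
  have "P p *v (?D *v \<sigma> p) + ?D *v (P p *v \<sigma> p) = ?D *v \<sigma> p"
    using arg_cong[OF deriv_P[OF p, of X], of "\<lambda>A. A *v \<sigma> p"]
    by (simp add: matrix_vector_mult_add_rdistrib matrix_vector_mul_assoc)
  then have D: "?D *v \<sigma> p = P p *v (?D *v \<sigma> p) + ?D *v (P p *v \<sigma> p)" by simp
  have PP: "P p *v (P p *v x) = P p *v x" for x
    by (simp add: matrix_vector_mul_assoc P_idem[OF p])
  have "DV V \<sigma> c p X = P p *v (P p *v ?s + ?D *v \<sigma> p) + (?s - (P p *v ?s + ?D *v \<sigma> p))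
      - P p *v (?s - (P p *v ?s + ?D *v \<sigma> p))"
    by (simp add: DV_def 1 2 proj_orth_projector[OF P[OF p]] proj_orth_orth_projector[OF P[OF p]])
  also have "\<dots> = ?s - ?D *v \<sigma> p + P p *v (?D *v \<sigma> p) + P p *v (?D *v \<sigma> p)"
    by (simp add: matrix_vector_right_distrib matrix_vector_mult_diff_distrib PP)
  \<comment> \<open>Splitting \<open>?D *v \<sigma> p\<close> by \<open>D\<close> cancels one of the
    two equal terms.\<close>
  also have "\<dots> = ?s - (?D *v (P p *v \<sigma> p) - P p *v (?D *v \<sigma> p))"
    by (subst D) simp
  finally show ?thesis
    by (simp add: lie_bracket_def matrix_vector_mult_diff_rdistrib matrix_vector_mul_assoc)
qed

lemma NV_eq:
  assumes p: "p \<in> fst c"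
  shows "NV V c p X = lie_bracket (chart_deriv c P p X) (P p)"
  unfolding NV_def
  by (rule matrix_vector_linear_unique) (simp add: DV_eq[OF p chart_smooth_const] dtriv_chart_deriv)

lemma NV_smooth: "chart_smooth c (\<lambda>x. NV V c x X)"
proof (rule chart_smooth_cong)
  show "chart_smooth c (\<lambda>x. lie_bracket (chart_deriv c P x X) (P x))"
    unfolding lie_bracket_def
    by (intro chart_smooth_diff chart_smooth_mult P_smooth chart_smooth_chart_deriv)
qed (simp add: NV_eq)

lemma NV_linear: "p \<in> fst c \<Longrightarrow> linear (NV V c p)"
  using chart_deriv_is_linear[OF P_smooth]
  by (intro linearI) (simp_all add: NV_eq linear_add linear_cmul lie_bracket_simps scaleR_mscale)

text \<open>On sections \<open>DV V\<close> is d minus \<open>NV V\<close>, so on endomorphisms it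
  is d minus the bracket with \<open>NV V\<close>. All later computations use this form.\<close>

lemma ext_deriv_eq:
  assumes p: "p \<in> fst c" and \<omega>: "\<And>Z. chart_smooth c (\<lambda>x. \<omega> c x Z)"
  shows "ext_deriv (DV V) \<omega> c p X Y =
    (chart_deriv c (\<lambda>x. \<omega> c x Y) p X - lie_bracket (NV V c p X) (\<omega> c p Y))
    - (chart_deriv c (\<lambda>x. \<omega> c x X) p Y - lie_bracket (NV V c p Y) (\<omega> c p X))"
proof -
  have "endo_deriv (DV V) (\<lambda>x. \<omega> c x Y) c p X
      = chart_deriv c (\<lambda>x. \<omega> c x Y) p X - lie_bracket (NV V c p X) (\<omega> c p Y)" for X Y
    unfolding endo_deriv_def
  proof (rule matrix_vector_linear_unique)
    fix v :: "'k cvec"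
    have sm: "chart_smooth c (\<lambda>x. \<omega> c x Y *v v)" by (rule chart_smooth_mult_vec[OF \<omega> chart_smooth_const])
    show "DV V (\<lambda>x. \<omega> c x Y *v v) c p X - \<omega> c p Y *v DV V (\<lambda>_. v) c p X
        = (chart_deriv c (\<lambda>x. \<omega> c x Y) p X - lie_bracket (NV V c p X) (\<omega> c p Y)) *v v"
      by (simp add: DV_eq[OF p sm] DV_eq[OF p chart_smooth_const] NV_eq[OF p]
          chart_deriv_mult_vec[OF \<omega> chart_smooth_const p] lie_bracket_def[of "lie_bracket _ _"]
          matrix_vector_mult_diff_rdistrib matrix_vector_mul_assoc vec.neg)
  qed
  then show ?thesis by (simp add: ext_deriv_def)
qed

text \<open>\<open>NV V\<close> acts as dP on \<open>V\<close> and as -dP on \<open>orth V\<close>,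
  and dP exchanges the two; so exactly one of the two factors contributes a minus sign.\<close>

lemma NV_mult_NV:
  assumes p: "p \<in> fst c"
  shows "NV V c p X ** NV V c p Y = - (chart_deriv c P p X ** chart_deriv c P p Y)"
proof -
  let ?P = "P p" and ?X = "chart_deriv c P p X" and ?Y = "chart_deriv c P p Y"
  have "?X ** ?P ** ?Y ** ?P = ?X ** (?P ** ?Y ** ?P)" by (simp only: matrix_mul_assoc)
  then have 1: "?X ** ?P ** ?Y ** ?P = 0" "?P ** ?X ** ?P ** ?Y = 0" "?P ** ?X ** ?P = 0"
    using P_deriv_P[OF p] by (simp_all add: matrix_ring_simps)
  have "?X ** ?Y = ?X ** (?P ** ?Y + ?Y ** ?P)" by (simp add: deriv_P[OF p])
  also have "\<dots> = ?X ** ?P ** ?Y + ?X ** ?Y ** ?P" by (simp only: matrix_ring_simps)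
  also have "?X ** ?Y ** ?P = (?P ** ?X + ?X ** ?P) ** ?Y ** ?P" by (simp add: deriv_P[OF p])
  also have "\<dots> = ?P ** ?X ** ?Y ** ?P"
    using 1 by (simp add: matrix_ring_simps)
  finally have XY: "?X ** ?Y = ?X ** ?P ** ?Y + ?P ** ?X ** ?Y ** ?P" .
  have PP: "A ** ?P ** ?P = A ** ?P" for A
    by (simp add: P_idem[OF p] flip: matrix_mul_assoc)
  show ?thesis unfolding XY
    by (simp add: NV_eq[OF p] lie_bracket_def matrix_ring_simps 1 PP)
qed

text \<open>The second derivatives of \<open>P\<close> cancel by symmetry. What remains is brackets
  of first derivatives of \<open>P\<close>, which cancel against the brackets of \<open>NV V\<close>
  because of the sign in \<open>NV_mult_NV\<close>.\<close>

lemma ext_deriv_NV: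
  assumes p: "p \<in> fst c"
  shows "ext_deriv (DV V) (NV V) c p X Y = 0"
proof -
  have D: "chart_smooth c (\<lambda>x. chart_deriv c P x X)" for X
    by (rule chart_smooth_chart_deriv[OF P_smooth])
  have d: "chart_deriv c (\<lambda>x. NV V c x Y) p X =
      lie_bracket (chart_deriv c (\<lambda>x. chart_deriv c P x Y) p X) (P p)
      + lie_bracket (chart_deriv c P p Y) (chart_deriv c P p X)" for X Y
  proof -
    have "chart_deriv c (\<lambda>x. NV V c x Y) p X
        = chart_deriv c (\<lambda>x. chart_deriv c P x Y ** P x - P x ** chart_deriv c P x Y) p X"
      by (rule chart_deriv_cong[OF _ _ p])
        (auto simp: NV_eq lie_bracket_def intro!: chart_smooth_diff chart_smooth_mult D P_smooth)
    then show ?thesis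
      by (simp add: chart_deriv_diff chart_deriv_mult chart_smooth_mult D P_smooth p lie_bracket_def)
  qed
  have "lie_bracket (NV V c p X) (NV V c p Y) = - lie_bracket (chart_deriv c P p X) (chart_deriv c P p Y)"
    "lie_bracket (NV V c p Y) (NV V c p X) = - lie_bracket (chart_deriv c P p Y) (chart_deriv c P p X)"
    by (simp_all add: lie_bracket_def NV_mult_NV[OF p])
  then show ?thesis
    using lie_bracket_commute[of "chart_deriv c P p X" "chart_deriv c P p Y"]
    by (simp add: ext_deriv_eq[OF p, of "NV V", OF NV_smooth] d chart_deriv_commute[OF P_smooth p, of X Y])
qed

text \<open>The inner bracket is dP, and the bracket of dP with \<open>P\<close> is
  \<open>NV V\<close> again. So bracketing twice with \<open>P\<close> fixes \<open>NV V\<close>,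
  whereas it kills whatever commutes with \<open>P\<close>; this separates the parts of a gauge
  term.\<close>

lemma bracket_NV_P:
  assumes p: "p \<in> fst c"
  shows "lie_bracket (lie_bracket (NV V c p X) (P p)) (P p) = NV V c p X"
proof -
  have "lie_bracket (NV V c p X) (P p) = chart_deriv c P p X"
  proof -
    have "chart_deriv c P p X ** P p ** P p = chart_deriv c P p X ** P p"
      by (simp add: P_idem[OF p] flip: matrix_mul_assoc)
    then show ?thesis
      using deriv_P[OF p, of X] P_deriv_P[OF p, of X]
      by (simp add: NV_eq[OF p] lie_bracket_def matrix_ring_simps P_idem[OF p] add.commute)
  qed
  then show ?thesis by (simp add: NV_eq[OF p])
qed

lemma ext_deriv_lincomb:
  assumes p: "p \<in> fst c"
    and \<omega>: "\<And>Z. chart_smooth c (\<lambda>x. \<omega> c x Z)" and \<eta>: "\<And>Z. chart_smooth c (\<lambda>x. \<eta> c x Z)"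
    and \<tau>: "\<And>x Z. x \<in> fst c \<Longrightarrow> \<tau> c x Z = mscale a (\<omega> c x Z) + mscale b (\<eta> c x Z)"
  shows "ext_deriv (DV V) \<tau> c p X Y =
    mscale a (ext_deriv (DV V) \<omega> c p X Y) + mscale b (ext_deriv (DV V) \<eta> c p X Y)"
proof -
  have sm: "chart_smooth c (\<lambda>x. mscale a (\<omega> c x Z) + mscale b (\<eta> c x Z))" for Z
    by (intro chart_smooth_add chart_smooth_linear[OF linear_mscale] \<omega> \<eta>)
  have "chart_smooth c (\<lambda>x. \<tau> c x Z)" for Z by (rule chart_smooth_cong[OF sm]) (simp add: \<tau>)
  moreover have "chart_deriv c (\<lambda>x. \<tau> c x Y) p X
      = mscale a (chart_deriv c (\<lambda>x. \<omega> c x Y) p X) + mscale b (chart_deriv c (\<lambda>x. \<eta> c x Y) p X)" for X Y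
    using chart_deriv_cong[OF sm, of Y "\<lambda>x. \<tau> c x Y" p X] \<tau> p
    by (simp add: chart_deriv_add chart_smooth_linear[OF linear_mscale] \<omega> \<eta>
        chart_deriv_linear[OF linear_mscale])
  ultimately show ?thesis
    by (simp add: ext_deriv_eq[OF p] \<omega> \<eta> \<tau> p lie_bracket_simps mscale_simps algebra_simps)
qed

end

section \<open>Gauge transformation of the bundle and of its connection\<close>

text \<open>\<open>B\<close> is the logarithmic derivative g^-1 dg, kept abstract here; its formula
  in \<lambda>, \<open>NV V\<close> and \<open>q\<close> is supplied later.\<close>

locale gauged_projector_chart = projector_chart c V P
  for c :: "'m::topological_space chart" and V :: "'m \<Rightarrow> 'k::finite cvec set" and P +
  fixes g :: "'m \<Rightarrow> 'k cmat" and B :: "'m \<Rightarrow> complex \<Rightarrow> 'k cmat"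
  assumes g: "x \<in> fst c \<Longrightarrow> isometry (g x)"
    and g_smooth: "chart_smooth c g"
    and deriv_g: "p \<in> fst c \<Longrightarrow> chart_deriv c g p X = g p ** B p X"
begin

lemma g_invertible: "x \<in> fst c \<Longrightarrow> invertible (g x)"
  using isometryD(1)[OF g] .

sublocale gauged: projector_chart c "bundle_image g V" "\<lambda>x. conjugate (g x) (P x)"
proof
  show "orth_projector (bundle_image g V x) (conjugate (g x) (P x))" if "x \<in> fst c" for x
    unfolding bundle_image_def using isometry_orth_projector[OF g P] that by blast
  show "chart_smooth c (\<lambda>x. conjugate (g x) (P x))"
    by (rule chart_smooth_conjugate[OF g_smooth P_smooth g_invertible])
qed

text \<open>The projector of the image is the conjugate of \<open>P\<close>, and its derivative is
  the conjugate of dP plus the bracket of \<open>B\<close> with \<open>P\<close>; a further bracket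
  with \<open>P\<close> gives the formula.\<close>

lemma NV_gauged:
  assumes p: "p \<in> fst c"
  shows "NV (bundle_image g V) c p X =
    conjugate (g p) (NV V c p X + lie_bracket (lie_bracket (B p X) (P p)) (P p))"
  unfolding gauged.NV_eq[OF p] NV_eq[OF p]
  by (simp add: chart_deriv_conjugate[OF g_smooth g_invertible P_smooth p deriv_g[OF p]]
      flip: conjugate_lie_bracket[OF g_invertible[OF p]] lie_bracket_simps)

text \<open>Differentiating the conjugated form adds the bracket with \<open>B\<close>, and the
  connection of the image subtracts the bracket with \<open>NV V\<close> plus \<open>B\<close> minus
  \<open>R\<close>. Beyond the exterior derivative for \<open>V\<close>, only the bracket with
  \<open>R\<close> is left.\<close>

lemma ext_deriv_gauged:
  assumes p: "p \<in> fst c" and \<omega>: "\<And>Z. chart_smooth c (\<lambda>x. \<omega> c x Z)"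
    and \<tau>: "\<And>x Z. x \<in> fst c \<Longrightarrow> \<tau> c x Z = conjugate (g x) (\<omega> c x Z)"
    and R: "\<And>Z. NV (bundle_image g V) c p Z = conjugate (g p) (NV V c p Z + B p Z - R Z)"
  shows "ext_deriv (DV (bundle_image g V)) \<tau> c p X Y =
    conjugate (g p) (ext_deriv (DV V) \<omega> c p X Y + lie_bracket (R X) (\<omega> c p Y) - lie_bracket (R Y) (\<omega> c p X))"
proof -
  have sm: "chart_smooth c (\<lambda>x. conjugate (g x) (\<omega> c x Z))" for Z
    by (rule chart_smooth_conjugate[OF g_smooth \<omega> g_invertible])
  have \<tau>_smooth: "chart_smooth c (\<lambda>x. \<tau> c x Z)" for Z by (rule chart_smooth_cong[OF sm]) (simp add: \<tau>)
  have d: "chart_deriv c (\<lambda>x. \<tau> c x Y) p X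
      = conjugate (g p) (chart_deriv c (\<lambda>x. \<omega> c x Y) p X + lie_bracket (B p X) (\<omega> c p Y))" for X Y
    using chart_deriv_cong[OF sm, of Y "\<lambda>x. \<tau> c x Y" p X] \<tau> p
    by (simp add: chart_deriv_conjugate[OF g_smooth g_invertible \<omega> p deriv_g[OF p]])
  show ?thesis
    by (simp add: gauged.ext_deriv_eq[OF p, of \<tau>, OF \<tau>_smooth] ext_deriv_eq[OF p, of \<omega>, OF \<omega>] d \<tau> p R
        conjugate_simps lie_bracket_simps conjugate_lie_bracket[OF g_invertible[OF p]] algebra_simps)
qed

end

section \<open>Bundles over a Riemann surface\<close>

lemma times_differentiable_on_subset:
  "times_differentiable_on k f S \<Longrightarrow> T \<subseteq> S \<Longrightarrow> times_differentiable_on k f T"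
proof (induction k arbitrary: f)
  case 0
  then show ?case by (auto intro: continuous_on_subset)
next
  case (Suc k)
  then show ?case by auto
qed

lemma smooth_on_subset: "smooth_on S f \<Longrightarrow> T \<subseteq> S \<Longrightarrow> smooth_on T f"
  unfolding smooth_on_def using times_differentiable_on_subset by blast

section \<open>Charts, local frames and projector fields of subbundles\<close>

lemma riemann_surface_chart:
  assumes "riemann_surface M A" "c \<in> A"
  shows "chart c" "fst c \<subseteq> M"
proof -
  have h: "open (snd c ` fst c)" "homeomorphism (fst c) (snd c ` fst c) (snd c) (chart_inv c)"
    using assms by (auto simp: riemann_surface_def)
  then show "chart c" by unfold_locales (auto simp: homeomorphism_def)
  show "fst c \<subseteq> M" using assms by (auto simp: riemann_surface_def)
qed

lemma msmooth_chart_smooth: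
  assumes "riemann_surface M A"
  shows "msmooth A M f \<longleftrightarrow> (\<forall>c\<in>A. chart_smooth c f)"
proof -
  have "fst c \<inter> M = fst c" if "c \<in> A" for c
    using riemann_surface_chart(2)[OF assms that] by auto
  then show ?thesis by (simp add: msmooth_def chart_smooth_def o_def)
qed

lemma subbundle_frame:
  assumes "subbundle M A r E" "p \<in> M"
  obtains W and s :: "nat \<Rightarrow> 'm::topological_space \<Rightarrow> 'k::finite cvec"
  where "open W" "p \<in> W" "W \<subseteq> M" "\<forall>i<r. msmooth A W (s i)"
    "\<forall>x\<in>W. E x = vec.span ((\<lambda>i. s i x) ` {..<r})"
  using assms(1)[unfolded subbundle_def, THEN conjunct2, rule_format, OF assms(2)]
  by (elim exE conjE) (rule that)

lemma subbundle_cong: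
  assumes "subbundle M A r E" "\<And>p. p \<in> M \<Longrightarrow> E p = E' p"
  shows "subbundle M A r E'"
  unfolding subbundle_def
proof (intro conjI ballI)
  fix p assume p: "p \<in> M"
  show "vec.subspace (E' p)" "vec.dim (E' p) = r"
    using assms p by (auto simp: subbundle_def)
  obtain W s where W: "open W" "p \<in> W" "W \<subseteq> M" "\<forall>i<r. msmooth A W (s i)"
      "\<forall>x\<in>W. E x = vec.span ((\<lambda>i::nat. s i x) ` {..<r})"
    by (rule subbundle_frame[OF assms(1) p])
  then show "\<exists>W s. open W \<and> p \<in> W \<and> W \<subseteq> M \<and> (\<forall>i<r. msmooth A W (s i)) \<and>
      (\<forall>x\<in>W. E' x = vec.span ((\<lambda>i::nat. s i x) ` {..<r}))"
    using assms(2) by (intro exI[of _ W] exI[of _ s]) (metis subsetD)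
qed

lemma subbundle_bundle_image:
  assumes M: "riemann_surface M A" and g: "msmooth A M g" "\<And>p. p \<in> M \<Longrightarrow> isometry (g p)"
    and E: "subbundle M A r E"
  shows "subbundle M A r (bundle_image g E)"
  unfolding subbundle_def
proof (intro conjI ballI)
  fix p assume p: "p \<in> M"
  have lin: "Vector_Spaces.linear (*s) (*s) ((*v) (g x))" for x by unfold_locales
  show "vec.subspace (bundle_image g E p)"
    unfolding bundle_image_def by (rule vec.subspace_image) (use E p in \<open>auto simp: subbundle_def\<close>)
  have "inj ((*v) (g p))"
    using matrix_inv_mult_vec(2)[OF isometryD(1)[OF g(2)[OF p]]] by (metis injI)
  then have "vec.dim (bundle_image g E p) = vec.dim (E p)"
    unfolding bundle_image_def by (rule vec.dim_image_eq[OF lin inj_on_subset[OF _ subset_UNIV]])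
  then show "vec.dim (bundle_image g E p) = r" using E p by (simp add: subbundle_def)
  obtain W s where W: "open W" "p \<in> W" "W \<subseteq> M" "\<forall>i<r. msmooth A W (s i)"
      "\<forall>x\<in>W. E x = vec.span ((\<lambda>i::nat. s i x) ` {..<r})"
    by (rule subbundle_frame[OF E p])
  have "msmooth A W (\<lambda>x. g x *v s i x)" if "i < r" for i
    unfolding msmooth_def
  proof
    fix c assume c: "c \<in> A"
    interpret chart c by (rule riemann_surface_chart(1)[OF M c])
    have "smooth_on (snd c ` (fst c \<inter> W)) (\<lambda>z. g (chart_inv c z) *v s i (chart_inv c z))"
    proof (rule smooth_on_matrix_vector_mult[OF open_image[OF W(1)]])
      show "smooth_on (snd c ` (fst c \<inter> W)) (\<lambda>z. g (chart_inv c z))"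
        by (rule smooth_on_subset[of "snd c ` (fst c \<inter> M)"])
          (use g(1) c W(3) in \<open>auto simp: msmooth_def o_def\<close>)
      show "smooth_on (snd c ` (fst c \<inter> W)) (\<lambda>z. s i (chart_inv c z))"
        using W(4) that c by (auto simp: msmooth_def o_def)
    qed
    then show "smooth_on (snd c ` (fst c \<inter> W)) ((\<lambda>x. g x *v s i x) \<circ> chart_inv c)"
      by (simp add: o_def)
  qed
  moreover have "bundle_image g E x = vec.span ((\<lambda>i. g x *v s i x) ` {..<r})" if "x \<in> W" for x
    using W(5) that vec.span_image[of "g x" "(\<lambda>i. s i x) ` {..<r}"]
    by (simp add: bundle_image_def image_image)
  ultimately show "\<exists>W s. open W \<and> p \<in> W \<and> W \<subseteq> M \<and> (\<forall>i<r. msmooth A W (s i)) \<and>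
      (\<forall>x\<in>W. bundle_image g E x = vec.span ((\<lambda>i::nat. s i x) ` {..<r}))"
    using W(1-3) by (intro exI[of _ W] exI[of _ "\<lambda>i x. g x *v s i x"]) auto
qed

text \<open>The rank is the cardinality of a type \<open>'r\<close>, so that Gram matrices can be
  indexed by it; \<open>h\<close> relabels the frame, given with natural-number indices, by
  \<open>'r\<close>.\<close>

lemma local_gram_projector:
  assumes "nondegenerate_subbundle M A CARD('r) V" "p \<in> M"
  obtains W and f :: "'r::finite \<Rightarrow> 'm::topological_space \<Rightarrow> 'k::finite cvec"
  where "open W" "p \<in> W" "W \<subseteq> M" "\<And>j. msmooth A W (f j)"
    "\<And>x. x \<in> W \<Longrightarrow> invertible (\<chi> i j. mink (f i x) (f j x))"
    "\<And>x. x \<in> W \<Longrightarrow> orth_projector (V x) (gram_projector (\<lambda>j. f j x))"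
proof -
  obtain W s where W: "open W" "p \<in> W" "W \<subseteq> M" "\<forall>i<CARD('r). msmooth A W (s i)"
      "\<forall>x\<in>W. V x = vec.span ((\<lambda>i::nat. s i x) ` {..<CARD('r)})"
    by (rule subbundle_frame[OF _ assms(2)])
      (use assms(1) in \<open>auto simp: nondegenerate_subbundle_def\<close>)
  obtain h :: "'r \<Rightarrow> nat" where h: "range h = {..<CARD('r)}"
    using ex_bij_betw_finite_nat[of "UNIV :: 'r set"] by (auto simp: bij_betw_def atLeast0LessThan)
  have span: "V x = vec.span (range (\<lambda>j. s (h j) x))" if "x \<in> W" for x
  proof -
    have "(\<lambda>i. s i x) ` {..<CARD('r)} = range (\<lambda>j. s (h j) x)"
      unfolding h[symmetric] image_image ..
    then show ?thesis using W(5) that by simp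
  qed
  have dim: "vec.dim (vec.span (range (\<lambda>j. s (h j) x))) = CARD('r)"
    and nondeg: "nondegenerate (vec.span (range (\<lambda>j. s (h j) x)))" if "x \<in> W" for x
    unfolding span[OF that, symmetric] using assms(1) that W(3)
    by (auto simp: nondegenerate_subbundle_def subbundle_def)
  show ?thesis
  proof (rule that[of W "\<lambda>j. s (h j)"])
    show "msmooth A W (s (h j))" for j using W(4) h by auto
    show "invertible (\<chi> i j. mink (s (h i) x) (s (h j) x))" if "x \<in> W" for x
      by (rule gram_invertible[OF dim nondeg, OF that that])
    show "orth_projector (V x) (gram_projector (\<lambda>j. s (h j) x))" if "x \<in> W" for x
      unfolding span[OF that] by (rule orth_projector_gram[OF dim nondeg, OF that that])
  qed (use W in auto)
qed

lemma orth_projector_matrix_proj: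
  "orth_projector S Q \<Longrightarrow> matrix (proj S) = Q"
  by (rule matrix_vector_linear_unique) (rule proj_orth_projector)

text \<open>The matrix of \<open>proj\<close> is defined on all of the chart without choices, and
  near each point it coincides with the smooth Gram projector of a local frame.\<close>

lemma smooth_projector_field:
  assumes M: "riemann_surface M A" and V: "nondegenerate_subbundle M A CARD('r::finite) V" and c: "c \<in> A"
  shows "projector_chart c V (\<lambda>x. matrix (proj (V x)))"
proof -
  interpret chart c by (rule riemann_surface_chart(1)[OF M c])
  have cM: "fst c \<subseteq> M" by (rule riemann_surface_chart(2)[OF M c])
  show ?thesis
  proof
    show "orth_projector (V x) (matrix (proj (V x)))" if "x \<in> fst c" for x
    proof -
      have "x \<in> M" using that cM by auto
      then obtain W and f :: "'r::finite \<Rightarrow> 'a \<Rightarrow> 'b cvec" where W: "open W" "x \<in> W" "W \<subseteq> M" "\<And>j. msmooth A W (f j)"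
        "\<And>x. x \<in> W \<Longrightarrow> invertible (\<chi> i j. mink (f i x) (f j x))"
        "\<And>x. x \<in> W \<Longrightarrow> orth_projector (V x) (gram_projector (\<lambda>j. f j x))"
        by (rule local_gram_projector[OF V]) (rule that)
      from W(6)[OF W(2)] show ?thesis by (simp add: orth_projector_matrix_proj)
    qed
    show "chart_smooth c (\<lambda>x. matrix (proj (V x)))"
      unfolding chart_smooth_def
    proof (rule smooth_on_local)
      fix z assume z: "z \<in> snd c ` fst c"
      define p where "p = chart_inv c z"
      have p: "p \<in> fst c" "z = snd c p" using z chart_inv by (auto simp: p_def)
      then have "p \<in> M" using cM by auto
      then obtain W and f :: "'r::finite \<Rightarrow> 'a \<Rightarrow> 'b cvec" where W: "open W" "p \<in> W" "W \<subseteq> M" "\<And>j. msmooth A W (f j)"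
        "\<And>x. x \<in> W \<Longrightarrow> invertible (\<chi> i j. mink (f i x) (f j x))"
        "\<And>x. x \<in> W \<Longrightarrow> orth_projector (V x) (gram_projector (\<lambda>j. f j x))"
        by (rule local_gram_projector[OF V]) (rule that)
      let ?U = "snd c ` (fst c \<inter> W)"
      have "smooth_on ?U (\<lambda>z. gram_projector (\<lambda>j. f j (chart_inv c z)))"
      proof (rule smooth_on_gram_projector[OF open_image[OF W(1)]])
        show "smooth_on ?U (\<lambda>z. f j (chart_inv c z))" for j
          using W(4)[of j] c by (auto simp: msmooth_def o_def)
        show "invertible (\<chi> i j. mink (f i (chart_inv c z)) (f j (chart_inv c z)))" if "z \<in> ?U" for z
          using that W(5) chart_inv by auto
      qed
      then have "smooth_on ?U (\<lambda>z. matrix (proj (V (chart_inv c z))))"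
        by (rule smooth_on_cong[OF open_image[OF W(1)], rotated])
          (auto simp: chart_inv orth_projector_matrix_proj[OF W(6)])
      then show "\<exists>U. open U \<and> z \<in> U \<and> smooth_on U (\<lambda>z. matrix (proj (V (chart_inv c z))))"
        using open_image[OF W(1)] p W(2) by blast
    qed
  qed
qed

section \<open>Types of one-forms\<close>

text \<open>\<open>a\<close> and \<open>b\<close> are the coefficients of dz and of its conjugate,
  that is, the values of the two typed parts at 1. With them, identities between forms at a point
  become algebraic identities in \<open>X\<close>, \<open>Y\<close> and the coefficient
  matrices.\<close>

lemma linear_form_decomp:
  fixes \<omega> :: "complex \<Rightarrow> complex^'n^'n"
  assumes "linear \<omega>"
  obtains a b where "\<And>X. \<omega> X = mscale X a + mscale (cnj X) b"
proof -
  define a where "a = mscale (1/2) (\<omega> 1 - mscale \<i> (\<omega> \<i>))"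
  define b where "b = mscale (1/2) (\<omega> 1 + mscale \<i> (\<omega> \<i>))"
  have "\<omega> X = mscale X a + mscale (cnj X) b" for X
  proof -
    have "X = Re X *\<^sub>R 1 + Im X *\<^sub>R \<i>" by (simp add: complex_eq_iff)
    then have "\<omega> X = \<omega> (Re X *\<^sub>R 1 + Im X *\<^sub>R \<i>)" by (rule arg_cong)
    also have "\<dots> = mscale (Re X) (\<omega> 1) + mscale (Im X) (\<omega> \<i>)"
      by (simp only: linear_add[OF assms] linear_cmul[OF assms] scaleR_mscale)
    also have "\<dots> = mscale (Re X + \<i> * Im X) a + mscale (Re X - \<i> * Im X) b"
      by (simp add: a_def b_def vec_eq_iff field_simps)
    also have "complex_of_real (Re X) + \<i> * Im X = X" by (simp add: complex_eq_iff)
    also have "complex_of_real (Re X) - \<i> * Im X = cnj X" by (simp add: complex_eq_iff)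
    finally show ?thesis .
  qed
  then show ?thesis by (rule that)
qed

lemma form_parts_decomp:
  assumes "\<And>X. \<omega> c p X = mscale X a + mscale (cnj X) b"
  shows "form10 mscale \<omega> c p X = mscale X a" "form01 mscale \<omega> c p X = mscale (cnj X) b"
    "form_star \<omega> c p X = mscale (- \<i> * X) a + mscale (\<i> * cnj X) b"
  by (simp_all add: form10_def form01_def form_star_def assms vec_eq_iff algebra_simps)

lemma form10_add_form01:
  "form10 mscale \<omega> c p X + form01 mscale \<omega> c p X = \<omega> c p X"
  by (simp add: form10_def form01_def vec_eq_iff field_simps)

lemma form_conjugate:
  assumes "\<And>X. \<omega> c p X = conjugate g (\<eta> c p X)"
  shows "form10 mscale \<omega> c p X = conjugate g (form10 mscale \<eta> c p X)"
    "form01 mscale \<omega> c p X = conjugate g (form01 mscale \<eta> c p X)"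
    "form_star \<omega> c p X = conjugate g (form_star \<eta> c p X)"
  by (simp_all add: form10_def form01_def form_star_def assms conjugate_simps)

section \<open>The spectral deformation\<close>

text \<open>One spectral parameter \<open>l\<close> is fixed, and \<open>g\<close> is the
  isomorphism belonging to it.\<close>

locale spectral_deformation =
  fixes M :: "'m::{t2_space,second_countable_topology} set" and A :: "'m chart set"
    and q :: "('m, 'k::finite cmat) form" and \<Delta>10 \<Delta>01 V :: "'m \<Rightarrow> 'k cvec set"
    and l :: complex and g :: "'m \<Rightarrow> 'k cmat"
  assumes surface: "riemann_surface M A"
    and willmore: "constrained_willmore M A q \<Delta>10 \<Delta>01"
    and congruence: "q_central_sphere_congruence M A q \<Delta>10 \<Delta>01 V"
    and l: "l \<noteq> 0"
    and iso: "bundle_isomorphism M A (dlam l q V) dtriv g"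
begin

definition P :: "'m \<Rightarrow> 'k cmat" where
  "P x = matrix (proj (V x))"

text \<open>This turns out to be the logarithmic derivative of \<open>g\<close>. It is
  \<open>dlam\<close> on constant sections, read as a matrix.\<close>

definition B :: "('m, 'k cmat) form" where
  "B c p X = mscale (inverse l - 1) (form10 mscale (NV V) c p X)
     + mscale (l - 1) (form01 mscale (NV V) c p X)
     + mscale (inverse l ^ 2 - 1) (form10 mscale q c p X)
     + mscale (l ^ 2 - 1) (form01 mscale q c p X)"

abbreviation "q' \<equiv> Ad_form g (q_lam l q)"
abbreviation "V' \<equiv> bundle_image g V"

lemma chart_subset: "c \<in> A \<Longrightarrow> fst c \<subseteq> M"
  by (rule riemann_surface_chart(2)[OF surface])

lemma in_M: "c \<in> A \<Longrightarrow> p \<in> fst c \<Longrightarrow> p \<in> M"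
  using chart_subset by blast

lemma V_nondegenerate: "nondegenerate_subbundle M A 4 V"
  using congruence by (simp add: q_central_sphere_congruence_def central_sphere_congruence_def)

lemma q_one_form: "one_form A q"
  using willmore by (simp add: constrained_willmore_def)

lemma q_linear: "c \<in> A \<Longrightarrow> p \<in> fst c \<Longrightarrow> linear (q c p)"
  using q_one_form by (simp add: one_form_def)

lemma q_smooth: "c \<in> A \<Longrightarrow> chart_smooth c (\<lambda>x. q c x X)"
  using q_one_form by (simp add: one_form_def chart_smooth_def)

lemma projector: "c \<in> A \<Longrightarrow> projector_chart c V P"
  \<comment> \<open>The numeral type \<open>4\<close> serves as index type for the local
    frames.\<close>
  unfolding P_def using smooth_projector_field[where ?'r=4, OF surface _] V_nondegenerate by simp

lemma g_isometry: "p \<in> M \<Longrightarrow> isometry (g p)"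
  using iso by (simp add: bundle_isomorphism_def isometry_def)

lemma g_msmooth: "msmooth A M g"
  using iso by (simp add: bundle_isomorphism_def)

lemma g_invertible: "p \<in> M \<Longrightarrow> invertible (g p)"
  by (rule isometryD(1)[OF g_isometry])

text \<open>The intertwining property of \<open>g\<close> is tested on constant sections, which
  determine a matrix.\<close>

lemma deriv_g:
  assumes c: "c \<in> A" and p: "p \<in> fst c"
  shows "chart_deriv c g p X = g p ** B c p X"
proof -
  interpret projector_chart c V P by (rule projector[OF c])
  have sm: "chart_smooth c g" using g_msmooth c by (simp add: msmooth_chart_smooth[OF surface])
  have "chart_deriv c g p X *v v = (g p ** B c p X) *v v" for v
  proof -
    have "(\<lambda>_. v) \<in> sections M A (\<lambda>_. UNIV)"
      by (simp add: sections_def msmooth_def smooth_on_const o_def)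
    then have "g p *v dlam l q V (\<lambda>_. v) c p X = dtriv (\<lambda>x. g x *v v) c p X"
      using iso c p unfolding bundle_isomorphism_def by blast
    also have "\<dots> = chart_deriv c g p X *v v"
      by (simp add: dtriv_chart_deriv chart_deriv_mult_vec[OF sm chart_smooth_const p])
    also have "dlam l q V (\<lambda>_. v) c p X = B c p X *v v"
    proof -
      have "NV V c p X = form10 mscale (NV V) c p X + form01 mscale (NV V) c p X"
        by (rule form10_add_form01[symmetric])
      then have N: "NV V c p X *v v = form10 mscale (NV V) c p X *v v + form01 mscale (NV V) c p X *v v"
        by (metis matrix_vector_mult_add_rdistrib)
      \<comment> \<open>A constant section has derivative zero, so only minus \<open>NV V\<close>
        remains; this produces the -1 in the coefficients of the parts of \<open>NV V\<close> in
        \<open>B\<close>.\<close>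
      have DV: "DV V (\<lambda>_. v) c p X = - (NV V c p X *v v)"
        by (simp add: DV_eq[OF p chart_smooth_const] NV_eq[OF p])
      show ?thesis
        by (simp add: dlam_def B_def DV N mscale_mult_vec matrix_vector_mult_add_rdistrib vec_eq_iff algebra_simps)
    qed
    finally show ?thesis by (simp add: matrix_vector_mul_assoc)
  qed
  then show ?thesis by (simp add: matrix_eq)
qed

lemma gauged: "c \<in> A \<Longrightarrow> gauged_projector_chart c V P g (B c)"
proof -
  assume c: "c \<in> A"
  interpret projector_chart c V P by (rule projector[OF c])
  show ?thesis
    by unfold_locales
      (use c in \<open>auto simp: g_isometry in_M deriv_g msmooth_chart_smooth[OF surface, THEN iffD1, OF g_msmooth]\<close>)
qed

lemma q_values:
  assumes "c \<in> A" "p \<in> fst c"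
  shows "q c p X \<in> {S + T |S T. S \<in> wedge2 (V p) \<and> T \<in> wedge2 (orth (V p))}"
  using congruence assms
  by (simp add: q_central_sphere_congruence_def constrained_harmonic_def values_in_def)

lemma q_commutes:
  assumes c: "c \<in> A" and p: "p \<in> fst c"
  shows "lie_bracket (q c p X) (P p) = 0"
proof -
  interpret projector_chart c V P by (rule projector[OF c])
  obtain S T where "q c p X = S + T" "S \<in> wedge2 (V p)" "T \<in> wedge2 (orth (V p))"
    using q_values[OF c p] by blast
  then show ?thesis using wedge2_commute_projector[OF P[OF p]] by simp
qed

text \<open>Bracketing \<open>B\<close> twice with \<open>P\<close> kills the parts of
  \<open>q\<close> and fixes those of \<open>NV V\<close>. Adding \<open>NV V\<close> itself turns
  the coefficients \<open>inverse l - 1\<close> and \<open>l - 1\<close> into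
  \<open>inverse l\<close> and \<open>l\<close>.\<close>

lemma NV_V':
  assumes c: "c \<in> A" and p: "p \<in> fst c"
  shows "NV V' c p X = conjugate (g p)
    (mscale (inverse l) (form10 mscale (NV V) c p X) + mscale l (form01 mscale (NV V) c p X))"
proof -
  interpret gauged_projector_chart c V P g "B c" by (rule gauged[OF c])
  have q: "lie_bracket (form10 mscale q c p X) (P p) = 0" "lie_bracket (form01 mscale q c p X) (P p) = 0"
    using q_commutes[OF c p] by (simp_all add: form10_def form01_def lie_bracket_simps mscale_simps)
  have N: "lie_bracket (lie_bracket (form10 mscale (NV V) c p X) (P p)) (P p) = form10 mscale (NV V) c p X"
    "lie_bracket (lie_bracket (form01 mscale (NV V) c p X) (P p)) (P p) = form01 mscale (NV V) c p X"
    using bracket_NV_P[OF p] by (simp_all add: form10_def form01_def lie_bracket_simps mscale_simps)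
  have "NV V c p X + lie_bracket (lie_bracket (B c p X) (P p)) (P p)
      = (form10 mscale (NV V) c p X + form01 mscale (NV V) c p X)
        + (mscale (inverse l - 1) (form10 mscale (NV V) c p X) + mscale (l - 1) (form01 mscale (NV V) c p X))"
    by (simp add: B_def lie_bracket_simps mscale_simps q N form10_add_form01)
  also have "\<dots> = mscale (inverse l) (form10 mscale (NV V) c p X) + mscale l (form01 mscale (NV V) c p X)"
    by (simp add: vec_eq_iff algebra_simps)
  finally show ?thesis using NV_gauged[OF p, of X] by simp
qed

text \<open>The part of \<open>B\<close> that commutes with \<open>P\<close>; it equals
  \<open>q_lam l q\<close> minus \<open>q\<close>.\<close>

definition R :: "('m, 'k cmat) form" where
  "R c p X = mscale (inverse l ^ 2 - 1) (form10 mscale q c p X) + mscale (l ^ 2 - 1) (form01 mscale q c p X)"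

lemma NV_V'_R:
  assumes c: "c \<in> A" and p: "p \<in> fst c"
  shows "NV V' c p X = conjugate (g p) (NV V c p X + B c p X - R c p X)"
proof -
  interpret projector_chart c V P by (rule projector[OF c])
  have "NV V c p X + B c p X - R c p X
     = mscale (inverse l) (form10 mscale (NV V) c p X) + mscale l (form01 mscale (NV V) c p X)"
    by (simp add: B_def R_def vec_eq_iff algebra_simps
        flip: form10_add_form01[of "NV V" c p X])
  then show ?thesis using NV_V'[OF c p] by simp
qed

text \<open>Conjugation is complex linear and so preserves types; the two summands of
  \<open>q_lam\<close> are already of pure type.\<close>

lemma q'_parts:
  assumes c: "c \<in> A" and p: "p \<in> fst c"
  shows "form10 mscale q' c p X = conjugate (g p) (mscale (inverse l ^ 2) (form10 mscale q c p X))"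
    "form01 mscale q' c p X = conjugate (g p) (mscale (l ^ 2) (form01 mscale q c p X))"
proof -
  obtain a b where q: "\<And>X. q c p X = mscale X a + mscale (cnj X) b"
    using linear_form_decomp[OF q_linear[OF c p]] by blast
  have q': "q' c p X = conjugate (g p) (q_lam l q c p X)" for X
    by (simp add: Ad_form_def conjugate_def)
  have ql: "q_lam l q c p X = mscale X (mscale (inverse l ^ 2) a) + mscale (cnj X) (mscale (l ^ 2) b)" for X
    by (simp add: q_lam_def form_parts_decomp[of q, OF q] mscale_simps mult.commute)
  show "form10 mscale q' c p X = conjugate (g p) (mscale (inverse l ^ 2) (form10 mscale q c p X))"
    "form01 mscale q' c p X = conjugate (g p) (mscale (l ^ 2) (form01 mscale q c p X))"
    unfolding form_conjugate[of q' c p "g p" "q_lam l q", OF q'] form_parts_decomp[of "q_lam l q", OF ql] form_parts_decomp[of q, OF q]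
    by (simp_all add: mscale_simps mult.commute)
qed

lemma form_smooth:
  assumes c: "c \<in> A" and \<omega>: "\<And>X. chart_smooth c (\<lambda>x. \<omega> c x X)"
  shows "chart_smooth c (\<lambda>x. form10 mscale \<omega> c x X)" "chart_smooth c (\<lambda>x. form01 mscale \<omega> c x X)"
    "chart_smooth c (\<lambda>x. form_star \<omega> c x X)"
proof -
  interpret projector_chart c V P by (rule projector[OF c])
  show "chart_smooth c (\<lambda>x. form10 mscale \<omega> c x X)" "chart_smooth c (\<lambda>x. form01 mscale \<omega> c x X)"
    unfolding form10_def form01_def
    by (intro chart_smooth_linear[OF linear_mscale] chart_smooth_diff chart_smooth_add \<omega>)+
  show "chart_smooth c (\<lambda>x. form_star \<omega> c x X)"
    unfolding form_star_def
    using chart_smooth_linear[OF linear_uminus \<omega>] by simp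
qed

section \<open>The constrained harmonicity equations for the transformed bundle\<close>

lemma harmonic:
  assumes "c \<in> A" "p \<in> fst c"
  shows "ext_deriv (DV V) (form10 mscale q) c p X Y = mscale (1/2) (bracket_wedge q q c p X Y)"
    "ext_deriv (DV V) (form01 mscale q) c p X Y = mscale (1/2) (bracket_wedge q q c p X Y)"
    "ext_deriv (DV V) (form_star (NV V)) c p X Y = mscale 2 (bracket_wedge q (form_star (NV V)) c p X Y)"
  using congruence assms
  by (simp_all add: q_central_sphere_congruence_def constrained_harmonic_def)

lemma bracket_wedge_conjugate:
  assumes "invertible h" "\<And>X. \<mu> c p X = conjugate h (\<mu>' c p X)" "\<And>X. \<eta> c p X = conjugate h (\<eta>' c p X)"
  shows "bracket_wedge \<mu> \<eta> c p X Y = conjugate h (bracket_wedge \<mu>' \<eta>' c p X Y)"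
  by (simp add: bracket_wedge_def assms(2,3) conjugate_simps conjugate_lie_bracket[OF assms(1)])

text \<open>Let K be half of [q \<and> q]. Brackets of equal type vanish, and K is the mixed
  bracket. For the (1,0)-part, the equation for \<open>V\<close> gives l^-2 K and the bracket with
  \<open>R\<close> gives (1 - l^-2) K; the sum is K, and K is also half of the bracket of
  \<open>q_lam l q\<close> with itself, since l^-2 l^2 = 1. The (0,1)-part is analogous.\<close>

lemma harmonic_q':
  assumes c: "c \<in> A" and p: "p \<in> fst c"
  shows "ext_deriv (DV V') (form10 mscale q') c p X Y = mscale (1/2) (bracket_wedge q' q' c p X Y)"
    "ext_deriv (DV V') (form01 mscale q') c p X Y = mscale (1/2) (bracket_wedge q' q' c p X Y)"
proof -
  interpret gauged_projector_chart c V P g "B c" by (rule gauged[OF c])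
  obtain a b where q: "\<And>X. q c p X = mscale X a + mscale (cnj X) b"
    using linear_form_decomp[OF q_linear[OF c p]] by blast
  have q': "q' c p X = conjugate (g p) (q_lam l q c p X)" for X
    by (simp add: Ad_form_def conjugate_def)
  note parts = form_parts_decomp[of q, OF q]
  have rhs: "mscale (1/2) (bracket_wedge q' q' c p X Y)
      = conjugate (g p) (mscale (1/2) (bracket_wedge (q_lam l q) (q_lam l q) c p X Y))"
    using bracket_wedge_conjugate[of "g p" q' c p "q_lam l q" q' "q_lam l q", OF g_invertible[OF p] q' q']
    by (simp add: conjugate_simps)
  have ba: "lie_bracket b a = - lie_bracket a b" by (rule lie_bracket_commute)
  have ll: "inverse l ^ 2 * l ^ 2 = 1" using l by (simp add: power_inverse)
  let ?w10 = "\<lambda>c x X. mscale (inverse l ^ 2) (form10 mscale q c x X)"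
  let ?w01 = "\<lambda>c x X. mscale (l ^ 2) (form01 mscale q c x X)"
  have s10: "chart_smooth c (\<lambda>x. form10 mscale q c x Z)" and s01: "chart_smooth c (\<lambda>x. form01 mscale q c x Z)" for Z
    using form_smooth[OF c, of q] q_smooth[OF c] by blast+
  \<comment> \<open>A constant multiple is treated as a linear combination whose second coefficient
    is 0.\<close>
  have d10: "ext_deriv (DV V) ?w10 c p X Y = mscale (inverse l ^ 2) (mscale (1/2) (bracket_wedge q q c p X Y))"
    using ext_deriv_lincomb[OF p, of "form10 mscale q" "form10 mscale q" ?w10 "inverse l ^ 2" 0 X Y] s10 harmonic[OF c p]
    by (simp add: mscale_simps)
  have d01: "ext_deriv (DV V) ?w01 c p X Y = mscale (l ^ 2) (mscale (1/2) (bracket_wedge q q c p X Y))"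
    using ext_deriv_lincomb[OF p, of "form01 mscale q" "form01 mscale q" ?w01 "l ^ 2" 0 X Y] s01 harmonic[OF c p]
    by (simp add: mscale_simps)
  have "ext_deriv (DV V') (form10 mscale q') c p X Y = conjugate (g p) (ext_deriv (DV V) ?w10 c p X Y
      + lie_bracket (R c p X) (?w10 c p Y) - lie_bracket (R c p Y) (?w10 c p X))"
    by (rule ext_deriv_gauged[OF p, where \<omega> = ?w10 and R = "R c p"])
      (use chart_smooth_linear[OF linear_mscale s10] q'_parts[OF c] NV_V'_R[OF c p] in auto)
  also have "ext_deriv (DV V) ?w10 c p X Y
      + lie_bracket (R c p X) (?w10 c p Y) - lie_bracket (R c p Y) (?w10 c p X)
      = mscale (1/2) (bracket_wedge (q_lam l q) (q_lam l q) c p X Y)"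
    unfolding d10 unfolding bracket_wedge_def q_lam_def R_def parts q lie_bracket_simps ba
    using ll by (simp add: vec_eq_iff field_simps l)
  finally show "ext_deriv (DV V') (form10 mscale q') c p X Y = mscale (1/2) (bracket_wedge q' q' c p X Y)"
    unfolding rhs .
  have "ext_deriv (DV V') (form01 mscale q') c p X Y = conjugate (g p) (ext_deriv (DV V) ?w01 c p X Y
      + lie_bracket (R c p X) (?w01 c p Y) - lie_bracket (R c p Y) (?w01 c p X))"
    by (rule ext_deriv_gauged[OF p, where \<omega> = ?w01 and R = "R c p"])
      (use chart_smooth_linear[OF linear_mscale s01] q'_parts[OF c] NV_V'_R[OF c p] in auto)
  also have "ext_deriv (DV V) ?w01 c p X Y
      + lie_bracket (R c p X) (?w01 c p Y) - lie_bracket (R c p Y) (?w01 c p X)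
      = mscale (1/2) (bracket_wedge (q_lam l q) (q_lam l q) c p X Y)"
    unfolding d01 unfolding bracket_wedge_def q_lam_def R_def parts q lie_bracket_simps ba
    using ll by (simp add: vec_eq_iff field_simps l)
  finally show "ext_deriv (DV V') (form01 mscale q') c p X Y = mscale (1/2) (bracket_wedge q' q' c p X Y)"
    unfolding rhs .
qed

text \<open>Since \<open>R\<close> is \<open>q_lam l q\<close> minus \<open>q\<close>, the equation
  to check is (l + l^-1) [q \<and> *N] = [(q_lam + q) \<and> w], where N is \<open>NV V\<close> and
  w is the form \<open>?w\<close> that conjugates to the new star form. Brackets of equal type
  vanish, and the two mixed ones have matching coefficients.\<close>

lemma harmonic_V':
  assumes c: "c \<in> A" and p: "p \<in> fst c"
  shows "ext_deriv (DV V') (form_star (NV V')) c p X Y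
    = mscale 2 (bracket_wedge q' (form_star (NV V')) c p X Y)"
proof -
  interpret gauged_projector_chart c V P g "B c" by (rule gauged[OF c])
  obtain a b where q: "\<And>X. q c p X = mscale X a + mscale (cnj X) b"
    using linear_form_decomp[OF q_linear[OF c p]] by blast
  obtain \<alpha> \<beta> where N: "\<And>X. NV V c p X = mscale X \<alpha> + mscale (cnj X) \<beta>"
    using linear_form_decomp[OF NV_linear[OF p]] by blast
  have q': "q' c p X = conjugate (g p) (q_lam l q c p X)" for X
    by (simp add: Ad_form_def conjugate_def)
  \<comment> \<open>The (1,0)-part of N is (N + \<i> *N)/2 and the (0,1)-part is (N - \<i> *N)/2.
    Substituting them expresses the new star form through N and *N, whose exterior derivatives are
    both known.\<close>
  let ?w = "\<lambda>c x X. mscale (\<i> / 2 * (l - inverse l)) (NV V c x X) + mscale (1 / 2 * (l + inverse l)) (form_star (NV V) c x X)"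
  have star: "form_star (NV V') c x X = conjugate (g x) (?w c x X)" if x: "x \<in> fst c" for x X
  proof -
    obtain \<alpha> \<beta> where N: "\<And>X. NV V c x X = mscale X \<alpha> + mscale (cnj X) \<beta>"
      using linear_form_decomp[OF NV_linear[OF x]] by blast
    have "form_star (NV V') c x X = conjugate (g x) (- (mscale (inverse l) (form10 mscale (NV V) c x (\<i> * X))
        + mscale l (form01 mscale (NV V) c x (\<i> * X))))"
      by (simp add: form_star_def NV_V'[OF c x] conjugate_simps)
    also have "- (mscale (inverse l) (form10 mscale (NV V) c x (\<i> * X))
        + mscale l (form01 mscale (NV V) c x (\<i> * X))) = ?w c x X"
      unfolding form_parts_decomp[of "NV V", OF N] N
      by (simp add: vec_eq_iff field_simps l)
    finally show ?thesis .
  qed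
  have s: "chart_smooth c (\<lambda>x. form_star (NV V) c x Z)" for Z
    using form_smooth(3)[OF c, of "NV V"] NV_smooth by blast
  have sw: "chart_smooth c (\<lambda>x. ?w c x Z)" for Z
    by (intro chart_smooth_add chart_smooth_linear[OF linear_mscale] NV_smooth s)
  have dw: "ext_deriv (DV V) ?w c p X Y
      = mscale (1 / 2 * (l + inverse l)) (mscale 2 (bracket_wedge q (form_star (NV V)) c p X Y))"
    using ext_deriv_lincomb[OF p, of "NV V" "form_star (NV V)" ?w "\<i> / 2 * (l - inverse l)" "1 / 2 * (l + inverse l)" X Y]
      NV_smooth s ext_deriv_NV[OF p] harmonic(3)[OF c p]
    by (simp add: mscale_simps)
  have "ext_deriv (DV V') (form_star (NV V')) c p X Y = conjugate (g p) (ext_deriv (DV V) ?w c p X Y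
      + lie_bracket (R c p X) (?w c p Y) - lie_bracket (R c p Y) (?w c p X))"
    by (rule ext_deriv_gauged[OF p, where \<omega> = ?w and R = "R c p"])
      (use sw star NV_V'_R[OF c p] in auto)
  also have "ext_deriv (DV V) ?w c p X Y
      + lie_bracket (R c p X) (?w c p Y) - lie_bracket (R c p Y) (?w c p X)
      = mscale 2 (bracket_wedge (q_lam l q) ?w c p X Y)"
    unfolding dw unfolding bracket_wedge_def q_lam_def R_def form_parts_decomp[of q, OF q]
      form_parts_decomp[of "NV V", OF N] q N lie_bracket_simps
    by (simp add: vec_eq_iff field_simps l power2_eq_square)
  also have "conjugate (g p) (mscale 2 (bracket_wedge (q_lam l q) ?w c p X Y))
      = mscale 2 (bracket_wedge q' (form_star (NV V')) c p X Y)"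
    using bracket_wedge_conjugate[of "g p" q' c p "q_lam l q" "form_star (NV V')" ?w, OF g_invertible[OF p] q' star[OF p]]
    by (simp add: conjugate_simps)
  finally show ?thesis .
qed


section \<open>Values of the transformed form and the transformed central sphere congruence\<close>

lemma V_subspace: "p \<in> M \<Longrightarrow> vec.subspace (V p)"
  using V_nondegenerate by (simp add: nondegenerate_subbundle_def subbundle_def)

lemma surface_subspace:
  "p \<in> M \<Longrightarrow> vec.subspace (\<Delta>10 p)" "p \<in> M \<Longrightarrow> vec.subspace (\<Delta>01 p)"
  using willmore by (simp_all add: constrained_willmore_def complexified_surface_def subbundle_def)

lemma surface_isotropic:
  assumes "p \<in> M"
  shows "isotropic (\<Delta>10 p)" "isotropic (\<Delta>01 p)"
  using willmore assms by (simp_all add: constrained_willmore_def complexified_surface_def)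

lemma q_parts_values:
  assumes "c \<in> A" "p \<in> fst c"
  shows "form10 mscale q c p X \<in> wedge2 (\<Delta>01 p)" "form01 mscale q c p X \<in> wedge2 (\<Delta>10 p)"
  using willmore assms by (simp_all add: constrained_willmore_def values_in_def)

lemma N_parts_kernel:
  assumes "c \<in> A" "p \<in> fst c"
  shows "v \<in> \<Delta>01 p \<Longrightarrow> form10 mscale (NV V) c p X *v v = 0"
    "v \<in> \<Delta>10 p \<Longrightarrow> form01 mscale (NV V) c p X *v v = 0"
  using congruence assms by (simp_all add: q_central_sphere_congruence_def central_sphere_congruence_def)

lemma q'_one_form: "one_form A q'"
  unfolding one_form_def
proof (intro conjI ballI allI)
  have q': "q' c p X = conjugate (g p) (q_lam l q c p X)" for c p X
    by (simp add: Ad_form_def conjugate_def)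
  show "linear (q' c p)" if c: "c \<in> A" and p: "p \<in> fst c" for c p
  proof -
    obtain a b where q: "\<And>X. q c p X = mscale X a + mscale (cnj X) b"
      using linear_form_decomp[OF q_linear[OF c p]] by blast
    have "linear (q_lam l q c p)"
      by (rule linearI)
        (simp_all add: q_lam_def form_parts_decomp[of q, OF q] vec_eq_iff algebra_simps
          scaleR_conv_of_real[where ?'a=complex])
    from linear_compose[OF this linear_conjugate] show ?thesis
      unfolding q'[abs_def] o_def .
  qed
  show "smooth_on (snd c ` fst c) (\<lambda>z. q' c (chart_inv c z) X)" if c: "c \<in> A" for c X
  proof -
    interpret gauged_projector_chart c V P g "B c" by (rule gauged[OF c])
    have "chart_smooth c (\<lambda>x. conjugate (g x) (q_lam l q c x X))"
      unfolding q_lam_def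
      by (intro chart_smooth_conjugate[OF g_smooth _ g_invertible] chart_smooth_add
          chart_smooth_linear[OF linear_mscale] form_smooth[OF c] q_smooth[OF c])
    then show ?thesis by (simp add: q' chart_smooth_def)
  qed
  \<comment> \<open>The derivative of the coordinate change acts by complex multiplication, so it
    commutes with \<i>, and both typed parts transform as \<open>q\<close> does.\<close>
  show "q' c p X = q' c2 p (deriv (snd c2 \<circ> chart_inv c) (snd c p) * X)"
    if "c \<in> A" "c2 \<in> A" "p \<in> fst c \<inter> fst c2" for c c2 p X
  proof -
    have q: "q c p Z = q c2 p (deriv (snd c2 \<circ> chart_inv c) (snd c p) * Z)" for Z
      using q_one_form that unfolding one_form_def by blast
    show ?thesis
      by (simp add: q' q_lam_def form10_def form01_def q mult.left_commute)
  qed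
qed

lemma q'_values:
  "values_in A q' (\<lambda>p. {S + T |S T. S \<in> wedge2 (V' p) \<and> T \<in> wedge2 (orth (V' p))})"
  unfolding values_in_def
proof (intro ballI allI)
  fix c p X assume c: "c \<in> A" and p: "p \<in> fst c"
  have pM: "p \<in> M" by (rule in_M[OF c p])
  \<comment> \<open>Expanding the two typed parts writes \<open>q_lam\<close> as a complex
    combination of two values of \<open>q\<close>, for which the decomposition along
    \<open>V\<close> is known.\<close>
  define x where "x = mscale ((inverse l ^ 2 + l ^ 2) / 2) (q c p X)
    + mscale (\<i> * (l ^ 2 - inverse l ^ 2) / 2) (q c p (\<i> * X))"
  have "mscale u (form10 mscale q c p X) + mscale w (form01 mscale q c p X)
      = mscale ((u + w) / 2) (q c p X) + mscale (\<i> * (w - u) / 2) (q c p (\<i> * X))" for u w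
    by (simp add: form10_def form01_def vec_eq_iff field_simps)
  then have x: "q_lam l q c p X = x" by (simp add: q_lam_def x_def)
  obtain S T where 1: "q c p X = S + T" "S \<in> wedge2 (V p)" "T \<in> wedge2 (orth (V p))"
    using q_values[OF c p] by blast
  obtain S' T' where 2: "q c p (\<i> * X) = S' + T'" "S' \<in> wedge2 (V p)" "T' \<in> wedge2 (orth (V p))"
    using q_values[OF c p] by blast
  let ?a = "(inverse l ^ 2 + l ^ 2) / 2" and ?b = "\<i> * (l ^ 2 - inverse l ^ 2) / 2"
  have "x = (mscale ?a S + mscale ?b S') + (mscale ?a T + mscale ?b T')"
    unfolding x_def 1(1) 2(1) by (simp add: mscale_simps)
  then have "q' c p X = conjugate (g p) (mscale ?a S + mscale ?b S') + conjugate (g p) (mscale ?a T + mscale ?b T')"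
    by (simp add: Ad_form_def x conjugate_simps flip: conjugate_def)
  moreover have "conjugate (g p) (mscale ?a S + mscale ?b S') \<in> wedge2 (V' p)"
    unfolding bundle_image_def using 1 2 V_subspace[OF pM]
    by (intro conjugate_wedge2 g_isometry pM subspace_add[OF subspace_wedge2] mscale_wedge2)
  moreover have "conjugate (g p) (mscale ?a T + mscale ?b T') \<in> wedge2 (orth (V' p))"
    unfolding bundle_image_def isometry_orth_image[OF g_isometry[OF pM]] using 1 2 subspace_orth
    by (intro conjugate_wedge2 g_isometry pM subspace_add[OF subspace_wedge2] mscale_wedge2)
  ultimately show "q' c p X \<in> {S + T |S T. S \<in> wedge2 (V' p) \<and> T \<in> wedge2 (orth (V' p))}"
    by blast
qed

lemma V'_nondegenerate: "nondegenerate_subbundle M A 4 V'"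
  using V_nondegenerate subbundle_bundle_image[OF surface g_msmooth g_isometry]
    isometry_nondegenerate_image[OF g_isometry]
  by (auto simp: nondegenerate_subbundle_def bundle_image_def)

lemma q'_parts_values:
  "values_in A (form10 mscale q') (\<lambda>p. wedge2 (bundle_image g \<Delta>01 p))"
  "values_in A (form01 mscale q') (\<lambda>p. wedge2 (bundle_image g \<Delta>10 p))"
  unfolding values_in_def bundle_image_def
  using q'_parts conjugate_wedge2[OF mscale_wedge2[OF q_parts_values(1) surface_subspace(2)] g_isometry]
    conjugate_wedge2[OF mscale_wedge2[OF q_parts_values(2) surface_subspace(1)] g_isometry] in_M
  by auto

text \<open>The typed parts of the new \<open>NV\<close> are conjugates of multiples of the old
  ones, so their kernels are carried along by \<open>g\<close>.\<close>

lemma sphere_congruence: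
  "central_sphere_congruence M A (bundle_image g \<Delta>10) (bundle_image g \<Delta>01) V'"
  unfolding central_sphere_congruence_def
proof (intro conjI ballI allI)
  show "nondegenerate_subbundle M A 4 V'" by (rule V'_nondegenerate)
  show "{u + v |u v. u \<in> bundle_image g \<Delta>10 p \<and> v \<in> bundle_image g \<Delta>01 p} \<subseteq> V' p" if p: "p \<in> M" for p
  proof -
    have "{u + v |u v. u \<in> \<Delta>10 p \<and> v \<in> \<Delta>01 p} \<subseteq> V p"
      using congruence p by (simp add: q_central_sphere_congruence_def central_sphere_congruence_def)
    then have "u + v \<in> V p" if "u \<in> \<Delta>10 p" "v \<in> \<Delta>01 p" for u v using that by blast
    then show ?thesis
      by (auto simp: bundle_image_def simp flip: matrix_vector_right_distrib)
  qed
  fix c p X assume c: "c \<in> A" and p: "p \<in> fst c"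
  interpret projector_chart c V P by (rule projector[OF c])
  obtain \<alpha> \<beta> where N: "\<And>X. NV V c p X = mscale X \<alpha> + mscale (cnj X) \<beta>"
    using linear_form_decomp[OF NV_linear[OF p]] by blast
  have N': "form10 mscale (NV V') c p X = conjugate (g p) (mscale (inverse l) (form10 mscale (NV V) c p X))"
    "form01 mscale (NV V') c p X = conjugate (g p) (mscale l (form01 mscale (NV V) c p X))"
  proof -
    let ?N = "\<lambda>c p X. mscale (inverse l) (form10 mscale (NV V) c p X) + mscale l (form01 mscale (NV V) c p X)"
    \<comment> \<open>Collecting coefficients of \<open>X\<close> and of its conjugate lets the
      typed parts of \<open>?N\<close> be read off.\<close>
    have "?N c p X = mscale X (mscale (inverse l) \<alpha>) + mscale (cnj X) (mscale l \<beta>)" for X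
      by (simp add: form_parts_decomp[of "NV V", OF N] mscale_simps mult.commute)
    note N2 = form_parts_decomp[of ?N, OF this]
    show "form10 mscale (NV V') c p X = conjugate (g p) (mscale (inverse l) (form10 mscale (NV V) c p X))"
      "form01 mscale (NV V') c p X = conjugate (g p) (mscale l (form01 mscale (NV V) c p X))"
      unfolding form_conjugate[of "NV V'" c p "g p" ?N, OF NV_V'[OF c p]] N2 form_parts_decomp[of "NV V", OF N]
      by (simp_all add: mscale_simps mult.commute)
  qed
  have inv: "invertible (g p)" by (rule g_invertible[OF in_M[OF c p]])
  show "form10 mscale (NV V') c p X *v v = 0" if "v \<in> bundle_image g \<Delta>01 p" for v
    using that N_parts_kernel(1)[OF c p]
    by (auto simp: bundle_image_def N' conjugate_mult_vec[OF inv] mscale_mult_vec)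
  show "form01 mscale (NV V') c p X *v v = 0" if "v \<in> bundle_image g \<Delta>10 p" for v
    using that N_parts_kernel(2)[OF c p]
    by (auto simp: bundle_image_def N' conjugate_mult_vec[OF inv] mscale_mult_vec)
qed

section \<open>The transformed pair is a surface\<close>

lemma image_Int:
  assumes "p \<in> M"
  shows "bundle_image g (\<lambda>p. \<Delta>10 p \<inter> \<Delta>01 p) p = bundle_image g \<Delta>10 p \<inter> bundle_image g \<Delta>01 p"
  by (rule set_eqI) (simp only: bundle_image_def Int_iff isometry_image_iff[OF g_isometry[OF assms]])

text \<open>An isotropic subspace lies in its own orthogonal complement, which its bivectors
  annihilate.\<close>

lemma isotropic_mult_vec_zero:
  assumes "S \<in> wedge2 E" "isotropic E" "v \<in> E"
  shows "S *v v = 0"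
  by (rule wedge2_mult_vec_orth[OF assms(1)]) (use assms in \<open>auto simp: isotropic_def orth_def\<close>)

lemma B_parts:
  assumes c: "c \<in> A" and p: "p \<in> fst c"
  shows "form10 mscale B c p X = mscale (inverse l - 1) (form10 mscale (NV V) c p X)
      + mscale (inverse l ^ 2 - 1) (form10 mscale q c p X)"
    "form01 mscale B c p X = mscale (l - 1) (form01 mscale (NV V) c p X)
      + mscale (l ^ 2 - 1) (form01 mscale q c p X)"
proof -
  interpret projector_chart c V P by (rule projector[OF c])
  obtain \<alpha> \<beta> where N: "\<And>X. NV V c p X = mscale X \<alpha> + mscale (cnj X) \<beta>"
    using linear_form_decomp[OF NV_linear[OF p]] by blast
  obtain a b where q: "\<And>X. q c p X = mscale X a + mscale (cnj X) b"
    using linear_form_decomp[OF q_linear[OF c p]] by blast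
  note parts = form_parts_decomp[of "NV V", OF N] form_parts_decomp[of q, OF q]
  have "B c p X = mscale X (mscale (inverse l - 1) \<alpha> + mscale (inverse l ^ 2 - 1) a)
      + mscale (cnj X) (mscale (l - 1) \<beta> + mscale (l ^ 2 - 1) b)" for X
    by (simp add: B_def parts vec_eq_iff algebra_simps)
  from form_parts_decomp[of B, OF this]
  show "form10 mscale B c p X = mscale (inverse l - 1) (form10 mscale (NV V) c p X)
      + mscale (inverse l ^ 2 - 1) (form10 mscale q c p X)"
    "form01 mscale B c p X = mscale (l - 1) (form01 mscale (NV V) c p X)
      + mscale (l ^ 2 - 1) (form01 mscale q c p X)"
    by (simp_all add: parts mscale_simps mult.commute)
qed

text \<open>With \<tau> = g^-1 \<sigma>, a section of the original intersection bundle, d\<sigma> is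
  \<open>g\<close> applied to d\<tau> + B \<tau>. In each type B \<tau> vanishes: \<tau> lies in
  both \<open>\<Delta>10\<close> and \<open>\<Delta>01\<close>, so \<open>N_parts_kernel\<close>
  removes the part from \<open>NV V\<close> and isotropy the part from \<open>q\<close>. The surface
  condition for \<tau> then carries over.\<close>

lemma dtriv_section:
  assumes \<sigma>: "\<sigma> \<in> sections M A (\<lambda>p. bundle_image g \<Delta>10 p \<inter> bundle_image g \<Delta>01 p)"
    and c: "c \<in> A" and p: "p \<in> fst c"
  shows "form10 (*s) (dtriv \<sigma>) c p X \<in> bundle_image g \<Delta>10 p"
    "form01 (*s) (dtriv \<sigma>) c p X \<in> bundle_image g \<Delta>01 p"
proof -
  define \<tau> where "\<tau> = (\<lambda>x. matrix_inv (g x) *v \<sigma> x)"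
  have \<sigma>_smooth: "chart_smooth c \<sigma>" if "c \<in> A" for c
    using \<sigma> that by (simp add: sections_def msmooth_chart_smooth[OF surface])
  have \<tau>_smooth: "chart_smooth c \<tau>" if "c \<in> A" for c
  proof -
    interpret gauged_projector_chart c V P g "B c" by (rule gauged[OF that])
    show ?thesis unfolding \<tau>_def
      by (intro chart_smooth_mult_vec chart_smooth_matrix_inv g_smooth g_invertible \<sigma>_smooth that)
  qed
  have \<tau>_in: "\<tau> x \<in> \<Delta>10 x \<and> \<tau> x \<in> \<Delta>01 x" if "x \<in> M" for x
    unfolding \<tau>_def isometry_image_iff[OF g_isometry[OF that], symmetric]
    using \<sigma> that by (simp add: sections_def bundle_image_def)
  have "\<tau> \<in> sections M A (\<lambda>p. \<Delta>10 p \<inter> \<Delta>01 p)"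
    using \<tau>_in \<tau>_smooth by (simp add: sections_def msmooth_chart_smooth[OF surface])
  then have d\<tau>: "form10 (*s) (dtriv \<tau>) c p X \<in> \<Delta>10 p" "form01 (*s) (dtriv \<tau>) c p X \<in> \<Delta>01 p"
    using willmore c p by (simp_all add: constrained_willmore_def complexified_surface_def values_in_def)
  interpret gauged_projector_chart c V P g "B c" by (rule gauged[OF c])
  have pM: "p \<in> M" by (rule in_M[OF c p])
  have d\<sigma>: "dtriv \<sigma> c p X = g p *v (dtriv \<tau> c p X + B c p X *v \<tau> p)" for X
  proof -
    have "chart_deriv c \<sigma> p X = chart_deriv c (\<lambda>x. g x *v \<tau> x) p X"
      by (rule chart_deriv_cong[OF chart_smooth_mult_vec[OF g_smooth \<tau>_smooth[OF c]] _ p])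
        (simp add: \<tau>_def matrix_inv_mult_vec g_invertible)
    also have "\<dots> = g p *v chart_deriv c \<tau> p X + (g p ** B c p X) *v \<tau> p"
      by (simp add: chart_deriv_mult_vec[OF g_smooth \<tau>_smooth[OF c] p] deriv_g[OF p])
    finally show ?thesis
      by (simp add: dtriv_chart_deriv matrix_vector_right_distrib matrix_vector_mul_assoc)
  qed
  have parts: "form10 (*s) (dtriv \<sigma>) c p X = g p *v (form10 (*s) (dtriv \<tau>) c p X + form10 mscale B c p X *v \<tau> p)"
    "form01 (*s) (dtriv \<sigma>) c p X = g p *v (form01 (*s) (dtriv \<tau>) c p X + form01 mscale B c p X *v \<tau> p)"
  proof -
    have "(1/2) *s (g p *v u - \<i> *s (g p *v w)) = g p *v ((1/2) *s (u - \<i> *s w))"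
      "(1/2) *s (g p *v u + \<i> *s (g p *v w)) = g p *v ((1/2) *s (u + \<i> *s w))" for u w
      by (simp_all only: matrix_vector_mult_smult matrix_vector_mult_diff_distrib matrix_vector_right_distrib)
    note g_linear = this
    show "form10 (*s) (dtriv \<sigma>) c p X = g p *v (form10 (*s) (dtriv \<tau>) c p X + form10 mscale B c p X *v \<tau> p)"
      unfolding form10_def d\<sigma> g_linear
      by (rule arg_cong[of _ _ "(*v) (g p)"])
        (simp add: mscale_mult_vec matrix_vector_mult_diff_rdistrib vec_eq_iff algebra_simps)
    show "form01 (*s) (dtriv \<sigma>) c p X = g p *v (form01 (*s) (dtriv \<tau>) c p X + form01 mscale B c p X *v \<tau> p)"
      unfolding form01_def d\<sigma> g_linear
      by (rule arg_cong[of _ _ "(*v) (g p)"])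
        (simp add: mscale_mult_vec matrix_vector_mult_add_rdistrib vec_eq_iff algebra_simps)
  qed
  have "form10 mscale B c p X *v \<tau> p = 0" "form01 mscale B c p X *v \<tau> p = 0"
    using \<tau>_in[OF pM] N_parts_kernel[OF c p] isotropic_mult_vec_zero[OF q_parts_values(1)[OF c p] surface_isotropic(2)[OF pM]]
      isotropic_mult_vec_zero[OF q_parts_values(2)[OF c p] surface_isotropic(1)[OF pM]]
    by (simp_all add: B_parts[OF c p] matrix_vector_mult_add_rdistrib mscale_mult_vec)
  then show "form10 (*s) (dtriv \<sigma>) c p X \<in> bundle_image g \<Delta>10 p"
    "form01 (*s) (dtriv \<sigma>) c p X \<in> bundle_image g \<Delta>01 p"
    using d\<tau> by (simp_all add: parts bundle_image_def)
qed

lemma surface_image: "complexified_surface M A (bundle_image g \<Delta>10) (bundle_image g \<Delta>01)"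
  unfolding complexified_surface_def
proof (intro conjI ballI)
  have \<Delta>: "subbundle M A 2 \<Delta>10" "subbundle M A 2 \<Delta>01" "subbundle M A 1 (\<lambda>p. \<Delta>10 p \<inter> \<Delta>01 p)"
    using willmore by (simp_all add: constrained_willmore_def complexified_surface_def)
  note image = subbundle_bundle_image[OF surface g_msmooth g_isometry]
  show "subbundle M A 2 (bundle_image g \<Delta>10)" "subbundle M A 2 (bundle_image g \<Delta>01)"
    using image \<Delta> by blast+
  \<comment> \<open>Image and intersection commute by invertibility of \<open>g\<close>, which is
    known over \<open>M\<close>; hence the comparison through \<open>subbundle_cong\<close>.\<close>
  show "subbundle M A 1 (\<lambda>p. bundle_image g \<Delta>10 p \<inter> bundle_image g \<Delta>01 p)"
    by (rule subbundle_cong[OF image[OF _ \<Delta>(3)]]) (auto simp: image_Int)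
  show "isotropic (bundle_image g \<Delta>10 p)" "isotropic (bundle_image g \<Delta>01 p)" if "p \<in> M" for p
    using surface_isotropic[OF that] isometryD(2)[OF g_isometry[OF that]]
    by (auto simp: isotropic_def bundle_image_def)
  show "values_in A (form10 (*s) (dtriv \<sigma>)) (bundle_image g \<Delta>10)"
    "values_in A (form01 (*s) (dtriv \<sigma>)) (bundle_image g \<Delta>01)"
    if "\<sigma> \<in> sections M A (\<lambda>p. bundle_image g \<Delta>10 p \<inter> bundle_image g \<Delta>01 p)" for \<sigma>
    using dtriv_section[OF that] by (auto simp: values_in_def)
qed

lemma q'_central_sphere_congruence:
  "q_central_sphere_congruence M A q' (bundle_image g \<Delta>10) (bundle_image g \<Delta>01) V'"
  unfolding q_central_sphere_congruence_def constrained_harmonic_def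
  using sphere_congruence V'_nondegenerate q'_one_form q'_values harmonic_q' harmonic_V' by blast

lemma q'_constrained_willmore:
  "constrained_willmore M A q' (bundle_image g \<Delta>10) (bundle_image g \<Delta>01)"
  unfolding constrained_willmore_def
  using surface_image q'_one_form q'_parts_values q'_central_sphere_congruence by blast

end

theorem theorem6p21:
  fixes M :: "'m::{t2_space,second_countable_topology} set"
    and A :: "'m chart set"
    and n :: nat
    and q :: "('m, complex ^ 'k::finite option ^ 'k option) form"
    and \<Delta>10 \<Delta>01 V :: "'m \<Rightarrow> (complex ^ 'k option) set"
    and \<phi> :: "complex \<Rightarrow> 'm \<Rightarrow> complex ^ 'k option ^ 'k option"
  assumes "n \<ge> 3" and "CARD('k) = n + 1"
    and "riemann_surface M A"
    and "constrained_willmore M A q \<Delta>10 \<Delta>01"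
    and "q_central_sphere_congruence M A q \<Delta>10 \<Delta>01 V"
    and "\<And>l. l \<noteq> 0 \<Longrightarrow> bundle_isomorphism M A (dlam l q V) dtriv (\<phi> l)"
  shows "\<forall>l. l \<noteq> 0 \<longrightarrow>
    constrained_willmore M A (Ad_form (\<phi> l) (q_lam l q))
      (bundle_image (\<phi> l) \<Delta>10) (bundle_image (\<phi> l) \<Delta>01) \<and>
    q_central_sphere_congruence M A (Ad_form (\<phi> l) (q_lam l q))
      (bundle_image (\<phi> l) \<Delta>10) (bundle_image (\<phi> l) \<Delta>01) (bundle_image (\<phi> l) V)"
proof (intro allI impI)
  fix l :: complex assume "l \<noteq> 0"
  then interpret spectral_deformation M A q \<Delta>10 \<Delta>01 V l "\<phi> l"
    using assms by unfold_locales auto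
  show "constrained_willmore M A (Ad_form (\<phi> l) (q_lam l q))
      (bundle_image (\<phi> l) \<Delta>10) (bundle_image (\<phi> l) \<Delta>01) \<and>
    q_central_sphere_congruence M A (Ad_form (\<phi> l) (q_lam l q))
      (bundle_image (\<phi> l) \<Delta>10) (bundle_image (\<phi> l) \<Delta>01) (bundle_image (\<phi> l) V)"
    using q'_constrained_willmore q'_central_sphere_congruence by blast
qed

end
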